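(* For all $a>-1$, the Gamma distribution $\gamma(a)$ on $\mathbb{R}_+$, whose density with respect to Lebesgue measure is proportional to $e^{-x}x^a$, belongs to $\mathscr{L}$.
   Context: Wiener space: the countable product of copies of $(\mathbb{R}, \mathfrak{B}(\mathbb{R}))$ equipped with the standard Gaussian measure; its coordinates $(Y_k)$ are i.i.d. standard Gaussian. For smooth cylindrical $F,R$, $\Gamma(F,R) = \sum_k (\partial_{y_k}F)(\partial_{y_k}R)$ (carré du champ), extended by closure. $\mathsf{L}$ is the associated self-adjoint (Ornstein--Uhlenbeck) generator, characterized by $\mathbf{E}[\Gamma(F,R)] = -\mathbf{E}[F\,\mathsf{L}R]$. $\mathbb{D}^\infty = \{F : \mathsf{L}^k F \in \mathrm{Dom}(\mathsf{L}) \cap \bigcap_{1<p<\infty} L^p \text{ for all } k\geq 0\}$. $\mathscr{L}$ is the set of laws $\mu$ on $\mathbb{R}$ that can be realized as the law of some $X\in\mathbb{D}^\infty$ for which there is $\theta>0$ with $\mathbf{E}[\Gamma(X,X)^{-\theta}]<\infty$. *)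

theory Defs
  imports "HOL-Probability.Probability"
begin

definition wiener :: "(nat \<Rightarrow> real) measure" where
  "wiener = (\<Pi>\<^sub>M k\<in>UNIV. density lborel (\<lambda>x. ennreal (std_normal_density x)))"

text \<open>
  Random variables are everywhere defined functions, but, apart from the cylindrical ones,
  they only matter up to almost sure equality. The carre du champ and the generator are therefore
  rendered as relations: \<open>carre F R H\<close> reads ``\<open>H\<close> is a version of \<open>\<Gamma>(F,R)\<close>''.
\<close>

definition Lp_wiener :: "real \<Rightarrow> ((nat \<Rightarrow> real) \<Rightarrow> real) set" where
  "Lp_wiener p = {F. F \<in> borel_measurable wiener \<and> integrable wiener (\<lambda>y. \<bar>F y\<bar> powr p)}"

definition pd :: "nat \<Rightarrow> ((nat \<Rightarrow> real) \<Rightarrow> real) \<Rightarrow> (nat \<Rightarrow> real) \<Rightarrow> real" where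
  "pd k F y = deriv (\<lambda>t. F (y(k := t))) (y k)"

definition iter_pd :: "nat list \<Rightarrow> ((nat \<Rightarrow> real) \<Rightarrow> real) \<Rightarrow> (nat \<Rightarrow> real) \<Rightarrow> real" where
  "iter_pd ks F = foldr pd ks F"

text \<open>
  \<open>F(y) = f(y\<^sub>0, \<dots>, y\<^sub>n\<^sub>-\<^sub>1)\<close> with \<open>f\<close> of class \<open>C\<^sup>\<infinity>\<close> on \<open>\<real>\<^sup>n\<close>, where \<open>f\<close> and
  all its partial derivatives have at most polynomial growth. Smoothness is expressed by the
  existence and continuity of the partial derivatives of all orders; for a function of finitely
  many coordinates, continuity in the product topology of \<open>nat \<Rightarrow> real\<close> is continuity on \<open>\<real>\<^sup>n\<close>.
  Starting from bounded or compactly supported \<open>f\<close> instead leads to the same closure.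
\<close>

definition smooth_cyl :: "((nat \<Rightarrow> real) \<Rightarrow> real) set" where
  "smooth_cyl = {F. \<exists>n.
     (\<forall>y z. (\<forall>i<n. y i = z i) \<longrightarrow> F y = F z) \<and>
     (\<forall>ks. continuous_on UNIV (iter_pd ks F) \<and>
           (\<forall>k y. (\<lambda>t. iter_pd ks F (y(k := t))) differentiable (at (y k))) \<and>
           (\<exists>C m. \<forall>y. \<bar>iter_pd ks F y\<bar> \<le> C * (1 + (\<Sum>i<n. \<bar>y i\<bar>)) ^ m))}"

text \<open>For cylindrical functions only finitely many terms of the series are nonzero.\<close>

definition carre_cyl ::
  "((nat \<Rightarrow> real) \<Rightarrow> real) \<Rightarrow> ((nat \<Rightarrow> real) \<Rightarrow> real) \<Rightarrow> (nat \<Rightarrow> real) \<Rightarrow> real" where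
  "carre_cyl F R y = (\<Sum>k. pd k F y * pd k R y)"

definition form_approx :: "(nat \<Rightarrow> (nat \<Rightarrow> real) \<Rightarrow> real) \<Rightarrow> ((nat \<Rightarrow> real) \<Rightarrow> real) \<Rightarrow> bool" where
  "form_approx Fs F \<longleftrightarrow>
     (\<forall>n. Fs n \<in> smooth_cyl) \<and> F \<in> Lp_wiener 2 \<and>
     (\<lambda>n. \<integral>y. (Fs n y - F y)\<^sup>2 \<partial>wiener) \<longlonglongrightarrow> 0 \<and>
     (\<forall>e>0. \<exists>N. \<forall>m\<ge>N. \<forall>n\<ge>N.
        (\<integral>y. carre_cyl (\<lambda>y. Fs m y - Fs n y) (\<lambda>y. Fs m y - Fs n y) y \<partial>wiener) < e)"

definition dom_form :: "((nat \<Rightarrow> real) \<Rightarrow> real) set" where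
  "dom_form = {F. \<exists>Fs. form_approx Fs F}"

definition carre ::
  "((nat \<Rightarrow> real) \<Rightarrow> real) \<Rightarrow> ((nat \<Rightarrow> real) \<Rightarrow> real) \<Rightarrow> ((nat \<Rightarrow> real) \<Rightarrow> real) \<Rightarrow> bool" where
  "carre F R H \<longleftrightarrow>
     integrable wiener H \<and>
     (\<exists>Fs Rs. form_approx Fs F \<and> form_approx Rs R \<and>
        (\<lambda>n. \<integral>y. \<bar>carre_cyl (Fs n) (Rs n) y - H y\<bar> \<partial>wiener) \<longlonglongrightarrow> 0)"

text \<open>
  \<open>generator R G\<close> reads ``\<open>R\<close> is in the domain of \<open>L\<close> and \<open>G\<close> is a version of \<open>L R\<close>''.
  For \<open>F\<close> and \<open>R\<close> in \<open>dom_form\<close>, \<open>\<Gamma>(F,R)\<close> has a version, and any two of them agree almost surely.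
\<close>

definition generator :: "((nat \<Rightarrow> real) \<Rightarrow> real) \<Rightarrow> ((nat \<Rightarrow> real) \<Rightarrow> real) \<Rightarrow> bool" where
  "generator R G \<longleftrightarrow>
     R \<in> dom_form \<and> G \<in> Lp_wiener 2 \<and>
     (\<forall>F\<in>dom_form. \<forall>H. carre F R H \<longrightarrow>
        (\<integral>y. H y \<partial>wiener) = - (\<integral>y. F y * G y \<partial>wiener))"

text \<open>\<open>U k\<close> is a version of the \<open>k\<close>-th iterate of \<open>L\<close> at \<open>F\<close>.\<close>

definition D_infty :: "((nat \<Rightarrow> real) \<Rightarrow> real) set" where
  "D_infty = {F. \<exists>U. U 0 = F \<and>
     (\<forall>k. generator (U k) (U (Suc k)) \<and> (\<forall>p>1. U k \<in> Lp_wiener p))}"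

text \<open>
  The value \<open>\<infinity>\<close> where \<open>H\<close> vanishes has to be given explicitly, since \<open>0 powr (-\<theta>) = 0\<close>.
\<close>

definition neg_moment :: "real \<Rightarrow> ((nat \<Rightarrow> real) \<Rightarrow> real) \<Rightarrow> ennreal" where
  "neg_moment \<theta> H = (\<integral>\<^sup>+y. (if H y > 0 then ennreal (H y powr (-\<theta>)) else \<infinity>) \<partial>wiener)"

definition regular_laws :: "real measure set" where
  "regular_laws = {\<mu>. \<exists>X\<in>D_infty. distr wiener borel X = \<mu> \<and>
     (\<exists>\<theta>>0. \<exists>H. carre X X H \<and> neg_moment \<theta> H < \<infinity>)}"

definition gamma_law :: "real \<Rightarrow> real measure" where
  "gamma_law a = density lborel
     (\<lambda>x. ennreal (indicator {0..} x * (exp (-x) * x powr a) / Gamma (a + 1)))"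

lemma prob_space_gamma_law:
  assumes "a > -1"
  shows "prob_space (gamma_law a)"
proof (rule prob_spaceI)
  have G: "Gamma (a + 1) > 0"
    using assms by (intro Gamma_real_pos) simp
  have "emeasure (gamma_law a) (space (gamma_law a)) =
      (\<integral>\<^sup>+x. ennreal (indicator {0..} x * (exp (-x) * x powr a) / Gamma (a + 1)) \<partial>lborel)"
    by (simp add: gamma_law_def emeasure_density)
  also have "\<dots> = (\<integral>\<^sup>+x. ennreal (indicator {0..} x * x powr (a + 1 - 1) / exp x) * ennreal (1 / Gamma (a + 1)) \<partial>lborel)"
    using G by (intro nn_integral_cong) (simp add: ennreal_mult'[symmetric] exp_minus field_simps)
  also have "\<dots> = (\<integral>\<^sup>+x. ennreal (indicator {0..} x * x powr (a + 1 - 1) / exp x) \<partial>lborel) * ennreal (1 / Gamma (a + 1))"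
    by (rule nn_integral_multc) simp
  also have "\<dots> = ennreal (Gamma (a + 1)) * ennreal (1 / Gamma (a + 1))"
    using assms by (subst Gamma_conv_nn_integral_real) auto
  also have "\<dots> = 1"
    using G by (simp add: ennreal_mult'[symmetric])
  finally show "emeasure (gamma_law a) (space (gamma_law a)) = 1" .
qed

end

theory Submission
  imports Defs
begin

text \<open>
  Let \<open>\<Phi>\<close> and \<open>F\<close> be the distribution functions of the standard normal law and of \<open>\<gamma>(a)\<close>, and let
  \<open>g = F\<^sup>-\<^sup>1 \<circ> \<Phi>\<close> be the monotone transport, so that \<open>X(y) = g(y\<^sub>0)\<close> has law \<open>\<gamma>(a)\<close>. With
  \<open>q = g'/g\<close> (\<open>transport\<close> and \<open>log_slope\<close> below) one finds the polynomial system \<open>g' = g q\<close>, \<open>q' = q (-y + g q - (a + 1) q)\<close>, so all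
  derivatives of \<open>g\<close> are polynomials in \<open>y\<close>, \<open>g\<close>, \<open>q\<close>. Tail estimates for both laws give
  \<open>g = O(1 + y\<^sup>2)\<close> and \<open>q = O(1 + \<bar>y\<bar>)\<close>; hence \<open>X\<close> is itself a smooth cylindrical function of
  polynomial growth, and so are all its iterates under \<open>L\<close>. Finally \<open>g' \<ge> c exp(-k y\<^sup>2)\<close>, so
  \<open>\<Gamma>(X,X) = g'(y\<^sub>0)\<^sup>2\<close> has a small negative moment.

  That the pointwise Ornstein--Uhlenbeck operator is the generator in the sense of the closed form
  follows from Gaussian integration by parts and the closability of the form.
\<close>

section \<open>The distribution functions and the transport map\<close>

text \<open>The obstacle is the left tail, where g tends to 0. One more derivative gives g'' = g'
  (-y + g' - a g'/g), and 1/g grows like an exponential of y^2 there, so for a \<noteq> 0 the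
  functions y, g and g' alone do not generate a differential algebra. Passing to q cures this: q =
  (\<Phi>'/\<Phi>) (F/(x F')) evaluated at x = g, and F/(x F') stays bounded near 0 because F is of
  order x^(a+1). What remains is the ratio \<Phi>'/\<Phi>, of linear growth; \<Phi>'/(1 - \<Phi>)
  plays the same role on the right. The polynomials in y, g and q are closed under differentiation
  and under multiplication by y, hence under f'' - y f', so the iterates of L are handled by
  stability of a class. The decay of g, of order \<Phi> to the power 1/(a+1), is what makes the
  exponent \<theta> depend on a. On the side of the form, \<open>carre\<close> admits arbitrary
  approximating sequences, so the identity defining the generator must be verified for all of them;
  closability reduces this to the constant sequence.\<close>

lemma cdf_density_has_real_derivative:
  fixes f :: "real \<Rightarrow> real"
  assumes fin: "finite_borel_measure (density lborel f)"
    and meas [measurable]: "f \<in> borel_measurable borel" and nonneg: "\<And>x. 0 \<le> f x"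
    and U: "open U" "x \<in> U" and cont: "continuous_on U f"
  shows "(cdf (density lborel f) has_real_derivative f x) (at x)"
proof -
  let ?M = "density lborel f"
  interpret M: finite_borel_measure ?M by fact
  \<comment> \<open>The argument stays on a compact interval inside \<open>U\<close>, because the
    gamma density can jump or blow up at 0.\<close>
  obtain e where e: "e > 0" "cball x e \<subseteq> U"
    using U open_contains_cball by metis
  define a where "a = x - e"
  define b where "b = x + e"
  have ab: "{a..b} \<subseteq> U" using e by (auto simp: a_def b_def cball_eq_atLeastAtMost)
  have cab: "continuous_on {a..b} f" using cont ab continuous_on_subset by blast
  have 1: "cdf ?M t = cdf ?M a + integral {a..t} f" if t: "t \<in> {a<..<b}" for t
  proof -
    have c: "continuous_on {a..t} f" using cab t by (auto elim: continuous_on_subset)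
    have si: "set_integrable lborel {a..t} f"
      unfolding set_integrable_def using borel_integrable_compact[OF compact_Icc c]
      by (simp add: indicator_def if_distrib cong: if_cong)
    have "cdf ?M t - cdf ?M a = measure ?M {a<..t}" using t by (intro M.cdf_diff_eq) auto
    also have "emeasure ?M {a<..t} = (\<integral>\<^sup>+x. ennreal (indicator {a..t} x * f x) \<partial>lborel)"
    proof (subst emeasure_density)
      have "AE x in lborel. x \<noteq> a" by (rule AE_lborel_singleton)
      then show "(\<integral>\<^sup>+x. ennreal (f x) * indicator {a<..t} x \<partial>lborel) = (\<integral>\<^sup>+x. ennreal (indicator {a..t} x * f x) \<partial>lborel)"
        by (intro nn_integral_cong_AE) (auto split: split_indicator elim!: eventually_mono)
    qed auto
    then have "measure ?M {a<..t} = (LINT x:{a..t}|lborel. f x)"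
      unfolding measure_def set_lebesgue_integral_def using nonneg
      by (subst integral_eq_nn_integral) (auto simp: indicator_def)
    also have "\<dots> = integral {a..t} f" by (rule set_borel_integral_eq_integral(2)[OF si])
    finally show ?thesis by simp
  qed
  have "((\<lambda>t. integral {a..t} f) has_real_derivative f x) (at x within {a..b})"
    using e by (intro integral_has_real_derivative cab) (auto simp: a_def b_def)
  then have "((\<lambda>t. cdf ?M a + integral {a..t} f) has_real_derivative f x) (at x within {a..b})"
    by (auto intro!: derivative_eq_intros)
  then have "((\<lambda>t. cdf ?M a + integral {a..t} f) has_real_derivative f x) (at x)"
    using e at_within_Icc_at[of a x b] by (simp add: a_def b_def)
  then show ?thesis
    by (rule has_field_derivative_transform_within_open[where S="{a<..<b}"])
       (use e 1 in \<open>auto simp: a_def b_def\<close>)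
qed

section \<open>Lower bounds for the tails of the standard normal law\<close>

lemma std_normal_density_ge:
  assumes "\<bar>t - y\<bar> * (1 + \<bar>y\<bar>) \<le> 1"
  shows "exp (-3/2) * std_normal_density y \<le> std_normal_density t"
proof -
  have A: "\<bar>t - y\<bar> * \<bar>y\<bar> \<le> 1" "\<bar>t - y\<bar> \<le> 1"
  proof -
    have "\<bar>t - y\<bar> + \<bar>t - y\<bar> * \<bar>y\<bar> \<le> 1" using assms by (simp add: algebra_simps)
    moreover have "0 \<le> \<bar>t - y\<bar> * \<bar>y\<bar>" by simp
    ultimately show "\<bar>t - y\<bar> * \<bar>y\<bar> \<le> 1" "\<bar>t - y\<bar> \<le> 1" by linarith+
  qed
  \<comment> \<open>Over a distance of order 1/(1 + |y|) the square changes by at most 2 + 1 = 3,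
    hence the factor \<open>exp (-3/2)\<close>.\<close>
  have "t\<^sup>2 = y\<^sup>2 + 2 * ((t - y) * y) + (t - y)\<^sup>2" by (simp add: power2_eq_square algebra_simps)
  moreover have "(t - y) * y \<le> 1" using A(1) by (metis abs_le_D1 abs_mult)
  moreover have "(t - y)\<^sup>2 \<le> 1" using A(2) abs_square_le_1 by blast
  ultimately have "t\<^sup>2 \<le> y\<^sup>2 + 3" by linarith
  then have "exp (-3/2 + -(y\<^sup>2) / 2) \<le> exp (-(t\<^sup>2) / 2)" by simp
  then have "exp (-3/2) * exp (-(y\<^sup>2) / 2) \<le> exp (-(t\<^sup>2) / 2)" by (simp only: exp_add)
  then show ?thesis by (simp add: normal_density_def divide_right_mono)
qed

lemma real_distribution_std_normal: "real_distribution std_normal_distribution"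
  by (simp add: real_dist_normal_dist)

text \<open>On an interval of length 1/(1 + |y|) with y in its closure the density stays comparable
  to its value at y, so the mass is at least a constant times density times length. The set
  \<open>A\<close> is left open so that both half-lines bounded by y share the argument.\<close>

lemma std_normal_measure_ge:
  fixes y u :: real
  assumes uv: "u \<le> y" "y \<le> u + 1 / (1 + \<bar>y\<bar>)"
    and A: "{u<..u + 1 / (1 + \<bar>y\<bar>)} \<subseteq> A" "A \<in> sets borel"
  shows "std_normal_density y \<le> exp (3/2) * (1 + \<bar>y\<bar>) * measure std_normal_distribution A"
proof -
  interpret real_distribution std_normal_distribution by (rule real_distribution_std_normal)
  let ?I = "{u<..u + 1 / (1 + \<bar>y\<bar>)}"
  have pos: "1 + \<bar>y\<bar> > 0" by linarith
  have "ennreal (exp (-3/2) * std_normal_density y / (1 + \<bar>y\<bar>))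
      = (\<integral>\<^sup>+t. ennreal (exp (-3/2) * std_normal_density y) * indicator ?I t \<partial>lborel)"
    using pos by (subst nn_integral_cmult_indicator) (auto simp flip: ennreal_mult'' simp: field_simps)
  also have "\<dots> \<le> (\<integral>\<^sup>+t. ennreal (std_normal_density t) * indicator ?I t \<partial>lborel)"
  proof (intro nn_integral_mono)
    fix t
    show "ennreal (exp (-3/2) * std_normal_density y) * indicator ?I t \<le> ennreal (std_normal_density t) * indicator ?I t"
    proof (cases "t \<in> ?I")
      case True
      then have "\<bar>t - y\<bar> \<le> 1 / (1 + \<bar>y\<bar>)" using uv by auto
      then have "\<bar>t - y\<bar> * (1 + \<bar>y\<bar>) \<le> 1" using pos by (simp add: field_simps)
      then show ?thesis using True std_normal_density_ge by (simp add: ennreal_leI)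
    qed simp
  qed
  also have "\<dots> = emeasure std_normal_distribution ?I"
    by (subst emeasure_density) auto
  also have "\<dots> \<le> emeasure std_normal_distribution A"
    using A by (intro emeasure_mono) auto
  also have "\<dots> = ennreal (measure std_normal_distribution A)" by (rule emeasure_eq_measure)
  finally have "exp (-3/2) * std_normal_density y / (1 + \<bar>y\<bar>) \<le> measure std_normal_distribution A"
    by (simp add: ennreal_le_iff)
  then have "exp (-3/2) * std_normal_density y \<le> measure std_normal_distribution A * (1 + \<bar>y\<bar>)"
    using pos by (simp add: pos_divide_le_eq)
  then have "exp (3/2) * (exp (-3/2) * std_normal_density y) \<le> exp (3/2) * (measure std_normal_distribution A * (1 + \<bar>y\<bar>))"
    by (intro mult_left_mono) auto
  moreover have "exp (3/2) * (exp (-3/2) * std_normal_density y) = std_normal_density y"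
    by (simp flip: exp_add mult.assoc)
  ultimately show ?thesis by (simp only: mult_ac)
qed

abbreviation "\<Phi> \<equiv> cdf std_normal_distribution"

text \<open>This is the linear growth of the inverse Mills ratio on both sides: an interval of
  length 1/(1 + |y|) fits into each half-line, ending or starting at y.\<close>

lemma std_normal_density_le_cdf:
  "std_normal_density y \<le> exp (3/2) * (1 + \<bar>y\<bar>) * \<Phi> y"
  "std_normal_density y \<le> exp (3/2) * (1 + \<bar>y\<bar>) * (1 - \<Phi> y)"
proof -
  interpret real_distribution std_normal_distribution by (rule real_distribution_std_normal)
  show "std_normal_density y \<le> exp (3/2) * (1 + \<bar>y\<bar>) * \<Phi> y"
    unfolding cdf_def by (rule std_normal_measure_ge[of "y - 1 / (1 + \<bar>y\<bar>)"]) auto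
  have "1 - \<Phi> y = measure std_normal_distribution {y<..}"
    unfolding cdf_def by (subst prob_compl[symmetric]) (auto intro!: arg_cong[where f="measure _"])
  moreover have "std_normal_density y \<le> exp (3/2) * (1 + \<bar>y\<bar>) * measure std_normal_distribution {y<..}"
    by (rule std_normal_measure_ge[of y]) auto
  ultimately show "std_normal_density y \<le> exp (3/2) * (1 + \<bar>y\<bar>) * (1 - \<Phi> y)" by simp
qed

lemma Phi_in_01: "0 < \<Phi> y" "\<Phi> y < 1"
proof -
  have p: "std_normal_density y > 0" by (simp add: normal_density_pos)
  have q: "exp (3/2) * (1 + \<bar>y\<bar>) > 0" by (simp add: add_pos_nonneg)
  show "0 < \<Phi> y" using less_le_trans[OF p std_normal_density_le_cdf(1)] q zero_less_mult_pos by blast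
  have "0 < 1 - \<Phi> y" using less_le_trans[OF p std_normal_density_le_cdf(2)] q zero_less_mult_pos by blast
  then show "\<Phi> y < 1" by simp
qed

text \<open>The factor 1 + |y| of the Mills bound is absorbed by \<open>exp (1 + y^2 / 2)\<close>,
  which doubles the Gaussian exponent from y^2/2 to y^2. The rate is crude, but a pure exponential
  is convenient for taking logarithms and real powers. In \<open>c\<close>,
  \<open>exp (-3/2)\<close> comes from the Mills bound and \<open>exp (-1)\<close> from the
  absorption.\<close>

lemma exp_neg_square_le_Phi:
  obtains c where "c > 0" "\<And>y. c * exp (- y\<^sup>2) \<le> \<Phi> y" "\<And>y. c * exp (- y\<^sup>2) \<le> 1 - \<Phi> y"
proof -
  define c where "c = 1 / sqrt (2 * pi) * exp (-3/2) * exp (-1)"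
  have c: "c > 0" by (simp add: c_def)
  have *: "c * exp (- y\<^sup>2) \<le> p" if p: "std_normal_density y \<le> exp (3/2) * (1 + \<bar>y\<bar>) * p" for y p :: real
  proof -
    have "0 \<le> (\<bar>y\<bar> - 1)\<^sup>2" by simp
    then have "\<bar>y\<bar> \<le> 1 + y\<^sup>2 / 2" by (simp add: power2_eq_square algebra_simps)
    have "1 + \<bar>y\<bar> \<le> exp \<bar>y\<bar>" by (rule exp_ge_add_one_self)
    also have "\<dots> \<le> exp (1 + y\<^sup>2 / 2)" using \<open>\<bar>y\<bar> \<le> 1 + y\<^sup>2 / 2\<close> by simp
    finally have A: "1 + \<bar>y\<bar> \<le> exp (1 + y\<^sup>2 / 2)" .
    have "p > 0"
    proof -
      have "0 < exp (3/2) * (1 + \<bar>y\<bar>) * p" using p normal_density_pos[of 1 0 y] by linarith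
      moreover have "exp (3/2) * (1 + \<bar>y\<bar>) > 0" by (simp add: add_pos_nonneg)
      ultimately show ?thesis using zero_less_mult_pos by blast
    qed
    have "std_normal_density y \<le> exp (3/2) * exp (1 + y\<^sup>2 / 2) * p"
      by (rule order_trans[OF p]) (use A \<open>p > 0\<close> in \<open>intro mult_right_mono mult_left_mono; simp\<close>)
    then have "std_normal_density y * exp (- (3/2 + 1 + y\<^sup>2 / 2)) \<le> exp (3/2 + 1 + y\<^sup>2/2) * p * exp (- (3/2 + 1 + y\<^sup>2 / 2))"
      by (intro mult_right_mono) (simp_all only: exp_add mult_ac exp_ge_zero)
    also have "\<dots> = p" by (simp only: mult.commute[of _ p] mult.assoc exp_minus_inverse mult_1_right)
    finally have "std_normal_density y * exp (- (3/2 + 1 + y\<^sup>2 / 2)) \<le> p" .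
    moreover have "std_normal_density y * exp (- (3/2 + 1 + y\<^sup>2 / 2)) = c * exp (- y\<^sup>2)"
    proof -
      have "- y\<^sup>2 / 2 + - (3/2 + 1 + y\<^sup>2 / 2) = -3/2 + -1 + - y\<^sup>2" by (simp add: field_simps)
      then have "exp (- y\<^sup>2 / 2) * exp (- (3/2 + 1 + y\<^sup>2 / 2)) = exp (-3/2) * exp (-1) * exp (- y\<^sup>2)"
        by (simp only: flip: exp_add)
      then show ?thesis by (simp add: normal_density_def c_def mult_ac)
    qed
    ultimately show ?thesis by simp
  qed
  show thesis by (rule that[OF c]) (intro * std_normal_density_le_cdf)+
qed

lemma Phi_has_real_derivative: "(\<Phi> has_real_derivative std_normal_density y) (at y)"
proof (rule cdf_density_has_real_derivative[where U=UNIV])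
  show "finite_borel_measure std_normal_distribution"
    using real_distribution_std_normal by (rule real_distribution.finite_borel_measure_M)
  show "continuous_on UNIV std_normal_density"
    unfolding normal_density_def by (intro continuous_intros) auto
qed auto

text \<open>The left side is largest at x = s, as ln u \<le> u - 1 with u = x/s shows; the extra
  factor \<open>exp (-s)\<close> of the maximum is dropped.\<close>

lemma powr_mult_exp_neg_le:
  fixes s x :: real
  assumes "s > 0" "x > 0"
  shows "x powr s * exp (- x) \<le> s powr s"
proof -
  have "ln (x / s) \<le> x / s - 1" using assms by (intro ln_le_minus_one) auto
  then have "s * ln (x / s) \<le> s * (x / s - 1)" using assms by (intro mult_left_mono) auto
  then have "s * ln x - x \<le> s * ln s" using assms by (simp add: ln_div algebra_simps)
  then have "exp (s * ln x - x) \<le> exp (s * ln s)" by simp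
  then show ?thesis using assms by (simp add: powr_def exp_diff exp_minus field_simps)
qed

section \<open>The gamma law: distribution function, tails and quantiles\<close>

context
  fixes a :: real
  assumes a: "a > -1"
begin

lemma Gamma_pos: "Gamma (a + 1) > 0"
  using a by (intro Gamma_real_pos) simp

lemma Gamma_nz: "Gamma (a + 1) \<noteq> 0" "Gamma (1 + a) \<noteq> 0"
  using Gamma_pos by (simp_all add: add.commute)

lemma real_distribution_gamma_law: "real_distribution (gamma_law a)"
proof -
  interpret prob_space "gamma_law a" using a by (rule prob_space_gamma_law)
  show ?thesis by unfold_locales (simp add: gamma_law_def)
qed

abbreviation "gamma_cdf \<equiv> cdf (gamma_law a)"

lemma emeasure_gamma_law:
  "A \<in> sets borel \<Longrightarrow> emeasure (gamma_law a) A
     = (\<integral>\<^sup>+x. ennreal (indicator {0..} x * (exp (-x) * x powr a) / Gamma (a + 1)) * indicator A x \<partial>lborel)"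
  unfolding gamma_law_def by (subst emeasure_density) auto

lemma gamma_cdf_nonpos: assumes "x \<le> 0" shows "gamma_cdf x = 0"
proof -
  have "emeasure (gamma_law a) {..x} = (\<integral>\<^sup>+(t::real). 0 \<partial>lborel)"
    unfolding emeasure_gamma_law[OF atMost_borel]
  proof (intro nn_integral_cong)
    fix t
    \<comment> \<open>The point t = 0 lies in the half-line when x = 0; there
      \<open>0 powr a\<close> is 0 by convention, also for negative a.\<close>
    consider "t < 0" | "t = 0" | "t > x" using assms by linarith
    then show "ennreal (indicator {0..} t * (exp (-t) * t powr a) / Gamma (a + 1)) * indicator {..x} t = 0"
      by cases auto
  qed
  then show ?thesis by (simp add: cdf_def measure_def)
qed

lemma gamma_cdf_has_real_derivative:
  assumes "x > 0"
  shows "(gamma_cdf has_real_derivative exp (-x) * x powr a / Gamma (a + 1)) (at x)"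
proof -
  let ?f = "\<lambda>x. indicator {0..} x * (exp (-x) * x powr a) / Gamma (a + 1)"
  have "(cdf (density lborel ?f) has_real_derivative ?f x) (at x)"
  proof (rule cdf_density_has_real_derivative[where U="{0<..}"])
    show "finite_borel_measure (density lborel ?f)"
      using real_distribution_gamma_law unfolding gamma_law_def
      by (rule real_distribution.finite_borel_measure_M)
    show "continuous_on {0<..} ?f"
      by (rule continuous_on_eq[where f="\<lambda>x. exp (-x) * x powr a / Gamma (a + 1)"])
         (use Gamma_pos in \<open>auto intro!: continuous_intros\<close>)
  qed (use assms Gamma_pos in auto)
  then show ?thesis using assms by (simp add: gamma_law_def)
qed

text \<open>Bounding \<open>exp (-t)\<close> by 1 leaves the explicit integral of t^a. The order
  x^(a+1) is the true one near 0, which is where the bound matters.\<close>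

lemma gamma_cdf_le: assumes "x \<ge> 0" shows "gamma_cdf x \<le> x powr (a + 1) / ((a + 1) * Gamma (a + 1))"
proof -
  have "emeasure (gamma_law a) {..x} \<le> (\<integral>\<^sup>+t. ennreal (t powr a / Gamma (a + 1)) * indicator {0..x} t \<partial>lborel)"
    using Gamma_pos
    by (subst emeasure_gamma_law, simp, intro nn_integral_mono)
       (auto simp: indicator_def intro!: ennreal_leI divide_right_mono mult_left_le_one_le)
  also have "\<dots> = ennreal (x powr (a + 1) / (a + 1) / Gamma (a + 1))"
    using Gamma_pos has_integral_powr_from_0[OF a assms]
    by (intro nn_integral_has_integral_lebesgue' has_integral_divide) auto
  finally have "emeasure (gamma_law a) {..x} \<le> ennreal (x powr (a + 1) / (a + 1) / Gamma (a + 1))" .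
  then show ?thesis unfolding cdf_def measure_def
    using a Gamma_pos by (intro enn2real_leI) auto
qed

text \<open>The function exp(-t) t^a (1 - a/t) has the primitive -exp(-t) t^a, and for t \<ge> 2 |a|
  its last factor is at least 1/2. Twice this function therefore dominates the density and
  integrates exactly, whatever the sign of a.\<close>

lemma gamma_cdf_tail_le:
  assumes "x > 0" "x \<ge> 2 * \<bar>a\<bar>"
  shows "1 - gamma_cdf x \<le> 2 * exp (-x) * x powr a / Gamma (a + 1)"
proof -
  interpret real_distribution "gamma_law a" by (rule real_distribution_gamma_law)
  let ?c = "2 / Gamma (a + 1)"
  have c: "?c > 0" using Gamma_pos by simp
  have nonneg: "0 \<le> 1 - a / t" and half: "1 / 2 \<le> 1 - a / t" if "t \<ge> x" for t
  proof -
    have "2 * a \<le> t" using that assms by linarith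
    then show "1 / 2 \<le> 1 - a / t" using that assms by (simp add: field_simps)
    then show "0 \<le> 1 - a / t" by linarith
  qed
  have tail: "1 - gamma_cdf x = prob {x<..}"
    unfolding cdf_def by (subst prob_compl[symmetric]) (auto intro!: arg_cong[where f="measure _"])
  have "emeasure (gamma_law a) {x<..} \<le> (\<integral>\<^sup>+t. ennreal (?c * exp (-t) * t powr a * (1 - a / t)) * indicator {x..} t \<partial>lborel)"
  proof (subst emeasure_gamma_law, simp, intro nn_integral_mono)
    fix t
    show "ennreal (indicator {0..} t * (exp (-t) * t powr a) / Gamma (a + 1)) * indicator {x<..} t
        \<le> ennreal (?c * exp (-t) * t powr a * (1 - a / t)) * indicator {x..} t"
    proof (cases "t > x")
      case True
      have "exp (-t) * t powr a / Gamma (a + 1) = ?c * exp (-t) * t powr a * (1 / 2)" by simp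
      also have "\<dots> \<le> ?c * exp (-t) * t powr a * (1 - a / t)"
        using half[of t] True c by (intro mult_left_mono) auto
      finally show ?thesis using True assms by (auto simp: ennreal_leI)
    qed simp
  qed
  also have "(\<integral>\<^sup>+t. ennreal (?c * exp (-t) * t powr a * (1 - a / t)) * indicator {x..} t \<partial>lborel)
     = 0 - (- (?c * exp (-x) * x powr a))"
  proof (rule nn_integral_FTC_atLeast)
    fix t assume t: "x \<le> t"
    then have "t > 0" using assms by simp
    then show "((\<lambda>t. - (?c * exp (-t) * t powr a)) has_real_derivative ?c * exp (-t) * t powr a * (1 - a / t)) (at t)"
      by (auto intro!: derivative_eq_intros simp: powr_diff Gamma_nz diff_divide_distrib algebra_simps)
    show "0 \<le> ?c * exp (-t) * t powr a * (1 - a / t)"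
      using nonneg[OF t] c by (intro mult_nonneg_nonneg) auto
  next
    have "((\<lambda>t. - (?c * (t powr a / exp t))) \<longlongrightarrow> - (?c * 0)) at_top"
      by (intro tendsto_intros) real_asymp
    then show "((\<lambda>t. - (?c * exp (-t) * t powr a)) \<longlongrightarrow> 0) at_top"
      by (simp add: exp_minus field_simps)
  qed auto
  finally have "ennreal (prob {x<..}) \<le> ennreal (?c * exp (-x) * x powr a)"
    by (simp add: emeasure_eq_measure)
  then have "prob {x<..} \<le> ?c * exp (-x) * x powr a"
    using c by (subst (asm) ennreal_le_iff) auto
  then show ?thesis unfolding tail by simp
qed

lemma gamma_cdf_strict_mono:
  assumes "0 < x" "x < y" shows "gamma_cdf x < gamma_cdf y"
proof (rule DERIV_pos_imp_increasing[OF assms(2)])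
  fix t assume "x \<le> t"
  then have "t > 0" using assms by simp
  then show "\<exists>d. (gamma_cdf has_real_derivative d) (at t) \<and> 0 < d"
    using Gamma_pos by (intro exI[of _ "exp (-t) * t powr a / Gamma (a + 1)"] conjI gamma_cdf_has_real_derivative) auto
qed

lemma gamma_cdf_isCont: "isCont gamma_cdf x"
proof -
  interpret real_distribution "gamma_law a" by (rule real_distribution_gamma_law)
  have "emeasure (gamma_law a) {x} = 0"
    by (subst emeasure_gamma_law) (auto intro!: nn_integral_null_set AE_iff_null_sets[THEN iffD1])
  then show ?thesis by (simp add: finite_borel_measure.isCont_cdf finite_borel_measure_M measure_def)
qed

lemma gamma_quantile_exists:
  assumes "0 < p" "p < 1"
  shows "\<exists>x>0. gamma_cdf x = p"
proof -
  interpret real_distribution "gamma_law a" by (rule real_distribution_gamma_law)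
  have "eventually (\<lambda>x. gamma_cdf x > p) at_top"
    using cdf_lim_at_top_prob assms(2) by (rule order_tendstoD)
  then obtain b where b: "\<And>x. x \<ge> b \<Longrightarrow> gamma_cdf x > p" by (auto simp: eventually_at_top_linorder)
  have "\<exists>x. 0 \<le> x \<and> x \<le> max b 1 \<and> gamma_cdf x = p"
    using assms b[of "max b 1"] gamma_cdf_isCont by (intro IVT) (auto simp: gamma_cdf_nonpos)
  then obtain x where x: "0 \<le> x" "gamma_cdf x = p" by blast
  with assms gamma_cdf_nonpos[of x] have "x \<noteq> 0" by auto
  with x show ?thesis by (intro exI[of _ x]) auto
qed

text \<open>Strict monotonicity on the positive half-line makes the chosen point unique whenever one
  exists, that is for 0 < p < 1; other values are arbitrary.\<close>

definition gamma_quantile :: "real \<Rightarrow> real" where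
  "gamma_quantile p = (SOME x. 0 < x \<and> gamma_cdf x = p)"

lemma gamma_quantile:
  assumes "0 < p" "p < 1" shows "gamma_quantile p > 0" "gamma_cdf (gamma_quantile p) = p"
  using someI_ex[OF gamma_quantile_exists[OF assms]] by (auto simp: gamma_quantile_def)

lemma gamma_cdf_inj: "0 < x \<Longrightarrow> 0 < y \<Longrightarrow> gamma_cdf x = gamma_cdf y \<Longrightarrow> x = y"
  using gamma_cdf_strict_mono by (metis less_irrefl linorder_less_linear)

lemma gamma_quantile_cdf:
  assumes "x > 0" shows "gamma_quantile (gamma_cdf x) = x"
proof -
  have "\<exists>y. 0 < y \<and> gamma_cdf y = gamma_cdf x" using assms by blast
  from someI_ex[OF this] show ?thesis using gamma_cdf_inj assms by (auto simp: gamma_quantile_def)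
qed

section \<open>The transport map and its differential system\<close>

definition transport :: "real \<Rightarrow> real" where "transport y = gamma_quantile (\<Phi> y)"

lemma transport_pos: "transport y > 0" and gamma_cdf_transport: "gamma_cdf (transport y) = \<Phi> y"
  using gamma_quantile[of "\<Phi> y"] Phi_in_01 by (auto simp: transport_def)

lemma transport_le_iff: assumes "x > 0" shows "transport y \<le> x \<longleftrightarrow> \<Phi> y \<le> gamma_cdf x"
  using gamma_cdf_strict_mono[of x "transport y"] gamma_cdf_strict_mono[of "transport y" x] assms transport_pos[of y] gamma_cdf_transport[of y]
  by (cases "transport y = x") (auto simp: not_le[symmetric])

text \<open>Differentiating F(g(y)) = \<Phi>(y) gives g' as the normal density at y over the gamma
  density at g(y); dividing by g turns the exponent -a into -(a + 1).\<close>

definition log_slope :: "real \<Rightarrow> real" where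
  "log_slope y = std_normal_density y * Gamma (a + 1) * exp (transport y) * transport y powr (- (a + 1))"

lemma log_slope_pos: "log_slope y > 0"
  using Gamma_pos transport_pos[of y] by (simp add: log_slope_def normal_density_pos)

lemma transport_mult_log_slope: "transport y * log_slope y = std_normal_density y * Gamma (a + 1) * exp (transport y) * transport y powr (- a)"
  using transport_pos[of y] powr_add[of "transport y" 1 "- (a + 1)"] by (simp add: log_slope_def)

lemma transport_has_real_derivative: "(transport has_real_derivative transport y * log_slope y) (at y)"
proof -
  have "(gamma_quantile has_derivative (*) (inverse (exp (- transport y) * transport y powr a / Gamma (a + 1)))) (at (\<Phi> y))"
  proof (rule has_derivative_inverse_strong_x[where S="{0<..}" and f=gamma_cdf])
    show "(gamma_cdf has_derivative (*) (exp (- transport y) * transport y powr a / Gamma (a + 1))) (at (gamma_quantile (\<Phi> y)))"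
      using gamma_cdf_has_real_derivative[OF transport_pos[of y]] by (simp add: has_field_derivative_def transport_def)
    show "(*) (exp (- transport y) * transport y powr a / Gamma (a + 1)) \<circ> (*) (inverse (exp (- transport y) * transport y powr a / Gamma (a + 1))) = id"
      using transport_pos[of y] Gamma_pos by (auto simp: fun_eq_iff field_simps)
    show "continuous_on {0<..} gamma_cdf" by (simp add: continuous_at_imp_continuous_on gamma_cdf_isCont)
    show "gamma_quantile (\<Phi> y) \<in> {0<..}" using transport_pos[of y] by (simp add: transport_def)
    show "gamma_cdf (gamma_quantile (\<Phi> y)) = \<Phi> y" using gamma_cdf_transport[of y] by (simp add: transport_def)
  qed (auto simp: gamma_quantile_cdf)
  then have "(gamma_quantile has_real_derivative inverse (exp (- transport y) * transport y powr a / Gamma (a + 1))) (at (\<Phi> y))"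
    by (simp add: has_field_derivative_def)
  from DERIV_chain2[OF this Phi_has_real_derivative]
  have "(transport has_real_derivative inverse (exp (- transport y) * transport y powr a / Gamma (a + 1)) * std_normal_density y) (at y)"
    by (simp add: transport_def[abs_def])
  also have "inverse (exp (- transport y) * transport y powr a / Gamma (a + 1)) * std_normal_density y = transport y * log_slope y"
    unfolding transport_mult_log_slope by (simp add: exp_minus powr_minus field_simps)
  finally show ?thesis .
qed

lemma log_slope_has_real_derivative: "(log_slope has_real_derivative log_slope y * (- y + transport y * log_slope y - (a + 1) * log_slope y)) (at y)"
proof -
  have 1: "(std_normal_density has_real_derivative - y * std_normal_density y) (at y)"
    unfolding normal_density_def by (auto intro!: derivative_eq_intros simp: field_simps)
  \<comment> \<open>The real power is moved into the exponential because ln g has derivative g'/g,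
    which is \<open>log_slope\<close> again; this is how the system closes up.\<close>
  have log_slope: "log_slope = (\<lambda>y. std_normal_density y * Gamma (a + 1) * exp (transport y - (a + 1) * ln (transport y)))"
  proof
    fix y
    have "exp (transport y - (a + 1) * ln (transport y)) = exp (transport y) * transport y powr (- (a + 1))"
      using transport_pos[of y] by (simp add: powr_def algebra_simps flip: exp_add)
    then show "log_slope y = std_normal_density y * Gamma (a + 1) * exp (transport y - (a + 1) * ln (transport y))"
      by (simp add: log_slope_def)
  qed
  let ?E = "\<lambda>y. exp (transport y - (a + 1) * ln (transport y))"
  have 2: "((\<lambda>y. ln (transport y)) has_real_derivative log_slope y) (at y)"
  proof -
    have "inverse (transport y) * (transport y * log_slope y) = log_slope y" using transport_pos[of y] by (simp add: field_simps)
    then show ?thesis using DERIV_chain2[OF DERIV_ln[OF transport_pos[of y]] transport_has_real_derivative[of y]] by (simp only:)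
  qed
  have 3: "(?E has_real_derivative ?E y * (transport y * log_slope y - (a + 1) * log_slope y)) (at y)"
    by (intro DERIV_chain2[OF DERIV_exp] DERIV_diff DERIV_cmult transport_has_real_derivative 2)
  have "((\<lambda>y. std_normal_density y * Gamma (a + 1) * ?E y) has_real_derivative
      - y * std_normal_density y * Gamma (a + 1) * ?E y
        + ?E y * (transport y * log_slope y - (a + 1) * log_slope y) * (std_normal_density y * Gamma (a + 1))) (at y)"
    by (rule DERIV_mult[OF DERIV_cmult_right[OF 1] 3])
  then have "(log_slope has_real_derivative
      - y * std_normal_density y * Gamma (a + 1) * ?E y
        + ?E y * (transport y * log_slope y - (a + 1) * log_slope y) * (std_normal_density y * Gamma (a + 1))) (at y)"
    unfolding log_slope .
  also have "- y * std_normal_density y * Gamma (a + 1) * ?E y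
        + ?E y * (transport y * log_slope y - (a + 1) * log_slope y) * (std_normal_density y * Gamma (a + 1))
      = (std_normal_density y * Gamma (a + 1) * ?E y) * (- y + transport y * log_slope y - (a + 1) * log_slope y)"
    by (simp add: algebra_simps)
  also have "std_normal_density y * Gamma (a + 1) * ?E y = log_slope y" by (rule fun_cong[OF log_slope, symmetric])
  finally show ?thesis .
qed

section \<open>Growth of the transport map and a lower bound for its derivative\<close>

lemma transport_le: obtains C where "\<And>y. transport y \<le> 2 * y\<^sup>2 + C"
proof -
  obtain c where c: "c > 0" "\<And>y. c * exp (- y\<^sup>2) \<le> 1 - \<Phi> y" using exp_neg_square_le_Phi by metis
  \<comment> \<open>A positive exponent dominating a. The threshold 2 s also guarantees g \<ge> 1
    and g \<ge> 2 |a|, as the tail bound requires.\<close>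
  define s where "s = \<bar>a\<bar> + 1"
  define K where "K = 2 * (2 powr s * s powr s) / Gamma (a + 1)"
  have K: "K > 0" using Gamma_pos by (simp add: K_def s_def)
  \<comment> \<open>The Gaussian lower bound for 1 - \<Phi>(y) is compared with the gamma tail at g.
    Half of the decay, exp(-g/2), pays for the power g^s; logarithms of what is left give g/2 \<le>
    y^2 + constant.\<close>
  have main: "transport y \<le> 2 * y\<^sup>2 + 2 * ln (K / c)" if transport: "transport y \<ge> 2 * s" for y
  proof -
    have g1: "transport y \<ge> 1" "transport y \<ge> 2 * \<bar>a\<bar>" using transport by (auto simp: s_def)
    have "c * exp (- y\<^sup>2) \<le> 1 - gamma_cdf (transport y)" using c(2)[of y] by (simp add: gamma_cdf_transport)
    also have "\<dots> \<le> 2 * exp (- transport y) * transport y powr a / Gamma (a + 1)"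
      using transport_pos g1 by (intro gamma_cdf_tail_le) auto
    also have "\<dots> \<le> 2 * exp (- transport y) * transport y powr s / Gamma (a + 1)"
      using g1 Gamma_pos by (intro divide_right_mono mult_left_mono powr_mono) (auto simp: s_def)
    also have "transport y powr s = 2 powr s * (transport y / 2) powr s"
      using transport_pos[of y] by (simp add: powr_divide)
    also have "exp (- transport y) = exp (- transport y / 2) * exp (- (transport y / 2))"
      by (simp flip: exp_add)
    also have "2 * (exp (- transport y / 2) * exp (- (transport y / 2))) * (2 powr s * (transport y / 2) powr s) / Gamma (a + 1)
       = 2 * exp (- transport y / 2) * 2 powr s / Gamma (a + 1) * ((transport y / 2) powr s * exp (- (transport y / 2)))" by simp
    also have "\<dots> \<le> 2 * exp (- transport y / 2) * 2 powr s / Gamma (a + 1) * (s powr s)"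
      using Gamma_pos transport_pos[of y] by (intro mult_left_mono powr_mult_exp_neg_le) (auto simp: s_def)
    also have "\<dots> = K * exp (- transport y / 2)" by (simp add: K_def)
    finally have "ln (c * exp (- y\<^sup>2)) \<le> ln (K * exp (- transport y / 2))"
      using c(1) K by (subst ln_le_cancel_iff) simp_all
    then have "ln c - y\<^sup>2 \<le> ln K - transport y / 2" using c(1) K by (simp add: ln_mult)
    then show ?thesis using c(1) K by (simp add: ln_div algebra_simps)
  qed
  have "transport y \<le> 2 * y\<^sup>2 + (2 * s + \<bar>2 * ln (K / c)\<bar>)" for y
    using main[of y] zero_le_power2[of y] by (cases "transport y \<ge> 2 * s") (force simp: s_def, linarith)
  then show thesis by (rule that)
qed

text \<open>By the Mills bound the normal density is at most (1 + |y|) times 1 - F(g) or F(g), up to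
  a constant, and the estimates of these in terms of g cancel against the factor \<open>?Z\<close>.
  For g \<ge> \<open>x0\<close> the upper tail leaves a multiple of 1/g; for smaller g the lower
  tail leaves a multiple of exp(g)/(a + 1). The two entries of \<open>C\<close> are the bounds in
  these two cases.\<close>

lemma log_slope_le: obtains C where "\<And>y. log_slope y \<le> C * (1 + \<bar>y\<bar>)"
proof -
  define x0 where "x0 = 2 * \<bar>a\<bar> + 1"
  define C where "C = max (2 * exp (3/2)) (exp (3/2) * exp x0 / (a + 1))"
  have "log_slope y \<le> C * (1 + \<bar>y\<bar>)" for y
  proof -
    let ?Z = "Gamma (a + 1) * exp (transport y) * transport y powr (- (a + 1))"
    have Z: "?Z > 0" using Gamma_pos transport_pos[of y] by simp
    have log_slope: "log_slope y = std_normal_density y * ?Z" by (simp add: log_slope_def)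
    have Z': "?Z * (exp (- transport y) * transport y powr a / Gamma (a + 1)) = 1 / transport y"
    proof -
      have "transport y powr (- (a + 1)) * transport y powr a = 1 / transport y"
        using transport_pos[of y] by (simp add: powr_neg_one flip: powr_add)
      moreover have "?Z * (exp (- transport y) * transport y powr a / Gamma (a + 1))
          = (Gamma (a + 1) / Gamma (a + 1)) * (exp (transport y) * exp (- transport y)) * (transport y powr (- (a + 1)) * transport y powr a)"
        by (simp only: mult_ac times_divide_eq_right times_divide_eq_left)
      ultimately show ?thesis using Gamma_pos by (simp only: exp_minus_inverse) simp
    qed
    have "log_slope y \<le> exp (3/2) * (1 + \<bar>y\<bar>) * (C / exp (3/2))"
    proof (cases "transport y \<ge> x0")
      case True
      have "log_slope y \<le> exp (3/2) * (1 + \<bar>y\<bar>) * (1 - \<Phi> y) * ?Z"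
        unfolding log_slope using Z by (intro mult_right_mono std_normal_density_le_cdf) auto
      also have "1 - \<Phi> y \<le> 2 * exp (- transport y) * transport y powr a / Gamma (a + 1)"
        unfolding gamma_cdf_transport[symmetric] using transport_pos True by (intro gamma_cdf_tail_le) (auto simp: x0_def)
      then have "exp (3/2) * (1 + \<bar>y\<bar>) * (1 - \<Phi> y) * ?Z
         \<le> exp (3/2) * (1 + \<bar>y\<bar>) * (2 * exp (- transport y) * transport y powr a / Gamma (a + 1)) * ?Z"
        using Z by (intro mult_right_mono mult_left_mono) (auto simp: add_nonneg_nonneg)
      also have "\<dots> = exp (3/2) * (1 + \<bar>y\<bar>) * (2 * (?Z * (exp (- transport y) * transport y powr a / Gamma (a + 1))))"
        by (simp only: mult_ac times_divide_eq_right times_divide_eq_left)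
      also have "\<dots> = exp (3/2) * (1 + \<bar>y\<bar>) * (2 / transport y)" unfolding Z' by simp
      also have "\<dots> \<le> exp (3/2) * (1 + \<bar>y\<bar>) * (C / exp (3/2))"
      proof (intro mult_left_mono)
        have "2 / transport y \<le> 2" using True transport_pos[of y] by (simp add: x0_def field_simps)
        also have "2 \<le> C / exp (3/2)" by (simp add: C_def field_simps)
        finally show "2 / transport y \<le> C / exp (3/2)" .
      qed (simp add: add_nonneg_nonneg)
      finally show ?thesis .
    next
      case False
      have "log_slope y \<le> exp (3/2) * (1 + \<bar>y\<bar>) * \<Phi> y * ?Z"
        unfolding log_slope using Z by (intro mult_right_mono std_normal_density_le_cdf) auto
      also have "\<Phi> y \<le> transport y powr (a + 1) / ((a + 1) * Gamma (a + 1))"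
        unfolding gamma_cdf_transport[symmetric] using transport_pos[of y] by (intro gamma_cdf_le) auto
      then have "exp (3/2) * (1 + \<bar>y\<bar>) * \<Phi> y * ?Z
         \<le> exp (3/2) * (1 + \<bar>y\<bar>) * (transport y powr (a + 1) / ((a + 1) * Gamma (a + 1))) * ?Z"
        using Z by (intro mult_right_mono mult_left_mono) (auto simp: add_nonneg_nonneg)
      also have "\<dots> = exp (3/2) * (1 + \<bar>y\<bar>) * (exp (transport y) / (a + 1))"
      proof -
        have "transport y powr (a + 1) * transport y powr (- (a + 1)) = 1"
          using transport_pos[of y] by (simp flip: powr_add)
        then have "transport y powr (a + 1) / ((a + 1) * Gamma (a + 1)) * ?Z = exp (transport y) / (a + 1)"
          using Gamma_nz(1) a by (simp add: divide_simps)
        then show ?thesis by (simp only: mult.assoc)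
      qed
      also have "\<dots> \<le> exp (3/2) * (1 + \<bar>y\<bar>) * (C / exp (3/2))"
      proof (intro mult_left_mono)
        have "exp (transport y) / (a + 1) \<le> exp x0 / (a + 1)" using False a by (intro divide_right_mono) auto
        also have "\<dots> \<le> C / exp (3/2)" by (simp add: C_def pos_le_divide_eq mult_ac)
        finally show "exp (transport y) / (a + 1) \<le> C / exp (3/2)" .
      qed (simp add: add_nonneg_nonneg)
      finally show ?thesis .
    qed
    then show ?thesis by (simp add: mult_ac)
  qed
  then show thesis by (rule that)
qed

text \<open>With s = a + 1, the factor exp(g) g^(-a) of the derivative equals g / (g^s exp(-g)),
  hence is at least g / s^s for either sign of a. Moreover c exp(-y^2) \<le> \<Phi>(y) = F(g), which
  is at most a constant times g^s, gives g \<ge> d exp(-y^2 / s). The rate \<open>k\<close> adds 1/2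
  from the normal density to 1/s from g.\<close>

lemma transport_mult_log_slope_ge: obtains c k where "c > 0" "k > 0" "\<And>y. c * exp (- k * y\<^sup>2) \<le> transport y * log_slope y"
proof -
  obtain c where c: "c > 0" "\<And>y. c * exp (- y\<^sup>2) \<le> \<Phi> y" using exp_neg_square_le_Phi by metis
  define s where "s = a + 1"
  have s: "s > 0" using a by (simp add: s_def)
  define d where "d = (c * s * Gamma (a + 1)) powr (1 / s)"
  have csg: "c * s * Gamma (a + 1) > 0" using c(1) s Gamma_pos by simp
  have d: "d > 0" using c(1) s Gamma_pos by (simp add: d_def)
  define e where "e = 1 / sqrt (2 * pi) * Gamma (a + 1) * d / s powr s"
  have e: "e > 0" using d s Gamma_pos by (simp add: e_def)
  define k where "k = 1/2 + 1 / s"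
  have "e * exp (- k * y\<^sup>2) \<le> transport y * log_slope y" for y
  proof -
    have "c * exp (- y\<^sup>2) \<le> transport y powr s / (s * Gamma (a + 1))"
      using c(2)[of y] gamma_cdf_le[of "transport y"] transport_pos[of y] by (simp add: gamma_cdf_transport s_def)
    then have "c * s * Gamma (a + 1) * exp (- y\<^sup>2) \<le> transport y powr s"
      using s Gamma_pos by (simp add: pos_le_divide_eq mult_ac)
    then have "(c * s * Gamma (a + 1) * exp (- y\<^sup>2)) powr (1 / s) \<le> (transport y powr s) powr (1 / s)"
      using csg s by (intro powr_mono2) auto
    then have "d * exp (- y\<^sup>2 / s) \<le> transport y"
      using csg s transport_pos[of y] by (simp add: powr_mult d_def powr_powr exp_powr_real)
    moreover have "transport y * (transport y powr a * exp (- transport y)) \<le> s powr s"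
      using powr_mult_exp_neg_le[OF s transport_pos[of y]] transport_pos[of y] powr_add[of "transport y" 1 a]
      by (simp add: s_def mult_ac add.commute)
    moreover have "0 \<le> transport y powr a * exp (- transport y)" by simp
    ultimately have "d * exp (- y\<^sup>2 / s) * (transport y powr a * exp (- transport y)) \<le> s powr s"
      by (meson mult_right_mono order_trans)
    then have *: "d * exp (- y\<^sup>2 / s) / s powr s \<le> exp (transport y) * transport y powr (- a)"
      using transport_pos[of y] s by (simp add: powr_minus exp_minus field_simps)
    have "- k * y\<^sup>2 = - y\<^sup>2 / 2 + - y\<^sup>2 / s" using s by (simp add: k_def field_simps)
    then have "e * exp (- k * y\<^sup>2) = std_normal_density y * Gamma (a + 1) * (d * exp (- y\<^sup>2 / s) / s powr s)"
      by (simp only: e_def normal_density_def exp_add) simp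
    also have "\<dots> \<le> std_normal_density y * Gamma (a + 1) * (exp (transport y) * transport y powr (- a))"
      using * Gamma_pos by (intro mult_left_mono) auto
    also have "\<dots> = transport y * log_slope y" by (simp add: transport_mult_log_slope)
    finally show ?thesis .
  qed
  moreover have "k > 0" using s by (simp add: k_def add_pos_pos)
  ultimately show thesis using that e by blast
qed

end

section \<open>Cylindrical functions and the Dirichlet form\<close>

text \<open>Over a countable index set the product and the Borel sigma-algebras agree, so continuity
  in the product topology yields measurability of all cylindrical functions.\<close>

lemma sets_wiener [measurable_cong]: "sets wiener = sets borel"
proof -
  have "sets wiener = sets (Pi\<^sub>M UNIV (\<lambda>i::nat. borel :: real measure))"
    unfolding wiener_def by (rule sets_PiM_cong) auto
  then show ?thesis by (simp add: sets_PiM_equal_borel)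
qed

lemma space_wiener [simp]: "space wiener = UNIV"
  using sets_eq_imp_space_eq[OF sets_wiener] by simp

interpretation wiener: prob_space wiener
  unfolding wiener_def using prob_space_normal_density[of 1 0]
  by (intro prob_space_PiM) auto

lemma distr_wiener_coord: "distr wiener std_normal_distribution (\<lambda>y. y k) = std_normal_distribution"
  unfolding wiener_def using prob_space_normal_density[of 1 0]
  by (subst distr_PiM_component) auto

lemma wiener_coord_measurable [measurable]: "(\<lambda>y. y k) \<in> borel_measurable wiener"
  unfolding measurable_cong_sets[OF sets_wiener refl]
  by (intro borel_measurable_continuous_onI continuous_intros) auto

section \<open>Continuous functions of polynomial growth and their integrability\<close>

definition depends_on :: "nat \<Rightarrow> ((nat \<Rightarrow> real) \<Rightarrow> real) \<Rightarrow> bool" where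
  "depends_on n F \<longleftrightarrow> (\<forall>y z. (\<forall>i<n. y i = z i) \<longrightarrow> F y = F z)"

text \<open>Growth is kept apart from dependence on finitely many coordinates: this class is stable
  under sums and products and lies in every L^p with p > 0, which is all that integrability
  arguments use.\<close>

definition tame :: "nat \<Rightarrow> ((nat \<Rightarrow> real) \<Rightarrow> real) \<Rightarrow> bool" where
  "tame n F \<longleftrightarrow> continuous_on UNIV F \<and> (\<exists>C m. \<forall>y. \<bar>F y\<bar> \<le> C * (1 + (\<Sum>i<n. \<bar>y i\<bar>)) ^ m)"

text \<open>The condition of \<open>smooth_cyl\<close> with the number of coordinates exposed, so
  that several functions can be brought to a common n.\<close>

definition smooth_in :: "nat \<Rightarrow> ((nat \<Rightarrow> real) \<Rightarrow> real) \<Rightarrow> bool" where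
  "smooth_in n F \<longleftrightarrow> depends_on n F \<and>
     (\<forall>ks. tame n (iter_pd ks F) \<and> (\<forall>k y. (\<lambda>t. iter_pd ks F (y(k := t))) differentiable (at (y k))))"

lemma smooth_cyl_iff: "F \<in> smooth_cyl \<longleftrightarrow> (\<exists>n. smooth_in n F)"
  unfolding smooth_cyl_def smooth_in_def depends_on_def tame_def mem_Collect_eq
  by (intro arg_cong[where f=Ex] ext) blast

text \<open>With C \<ge> 1 the whole bound is at least 1, so its exponent may be enlarged; this is
  used to pass from a real p to an integer in the L^p estimate.\<close>

lemma tameE:
  assumes "tame n F"
  obtains C m where "C \<ge> 1" "\<And>y. \<bar>F y\<bar> \<le> C * (1 + (\<Sum>i<n. \<bar>y i\<bar>)) ^ m"
proof -
  obtain C m where C: "\<And>y. \<bar>F y\<bar> \<le> C * (1 + (\<Sum>i<n. \<bar>y i\<bar>)) ^ m"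
    using assms unfolding tame_def by blast
  have "\<bar>F y\<bar> \<le> max C 1 * (1 + (\<Sum>i<n. \<bar>y i\<bar>)) ^ m" for y
    by (rule order_trans[OF C]) (intro mult_right_mono zero_le_power, auto intro!: add_nonneg_nonneg sum_nonneg)
  then show thesis by (intro that[of "max C 1"]) auto
qed

lemma tameI:
  assumes "continuous_on UNIV F" "\<And>y. \<bar>F y\<bar> \<le> C * (1 + (\<Sum>i<n. \<bar>y i\<bar>)) ^ m"
  shows "tame n F"
  using assms unfolding tame_def by blast

lemma tame_continuous: "tame n F \<Longrightarrow> continuous_on UNIV F"
  by (simp add: tame_def)

lemma one_le_radius: "1 \<le> 1 + (\<Sum>i<n. \<bar>y i :: real\<bar>)"
  by (simp add: sum_nonneg)

lemma radius_nonneg: "0 \<le> 1 + (\<Sum>i<n. \<bar>y i :: real\<bar>)"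
  by (simp add: sum_nonneg add_nonneg_nonneg)

lemma tame_mono:
  assumes "tame n F" "n \<le> n'"
  shows "tame n' F"
proof -
  obtain C m where C: "C \<ge> 1" "\<And>y. \<bar>F y\<bar> \<le> C * (1 + (\<Sum>i<n. \<bar>y i\<bar>)) ^ m"
    using tameE[OF assms(1)] by blast
  show ?thesis
  proof (rule tameI[OF tame_continuous[OF assms(1)]])
    fix y :: "nat \<Rightarrow> real"
    have "(\<Sum>i<n. \<bar>y i\<bar>) \<le> (\<Sum>i<n'. \<bar>y i\<bar>)" using assms(2) by (intro sum_mono2) auto
    then have "(1 + (\<Sum>i<n. \<bar>y i\<bar>)) ^ m \<le> (1 + (\<Sum>i<n'. \<bar>y i\<bar>)) ^ m"
      using radius_nonneg[of y n] by (intro power_mono) auto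
    then show "\<bar>F y\<bar> \<le> C * (1 + (\<Sum>i<n'. \<bar>y i\<bar>)) ^ m"
      using C(1) by (intro order_trans[OF C(2)] mult_left_mono) auto
  qed
qed

lemma tame_const: "tame n (\<lambda>_. c)"
  by (rule tameI[where C="\<bar>c\<bar>" and m=0]) auto

lemma tame_coord: assumes "k < n" shows "tame n (\<lambda>y. y k)"
proof (rule tameI[where C=1 and m=1])
  fix y :: "nat \<Rightarrow> real"
  have "\<bar>y k\<bar> \<le> (\<Sum>i<n. \<bar>y i\<bar>)" using assms by (intro member_le_sum) auto
  then show "\<bar>y k\<bar> \<le> 1 * (1 + (\<Sum>i<n. \<bar>y i\<bar>)) ^ 1" by simp
qed (auto intro!: continuous_intros)

lemma tame_add:
  assumes "tame n F" "tame n G"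
  shows "tame n (\<lambda>y. F y + G y)"
proof -
  obtain C m where C: "C \<ge> 1" "\<And>y. \<bar>F y\<bar> \<le> C * (1 + (\<Sum>i<n. \<bar>y i\<bar>)) ^ m"
    using tameE[OF assms(1)] by blast
  obtain D l where D: "D \<ge> 1" "\<And>y. \<bar>G y\<bar> \<le> D * (1 + (\<Sum>i<n. \<bar>y i\<bar>)) ^ l"
    using tameE[OF assms(2)] by blast
  show ?thesis
  proof (rule tameI[where C="C + D" and m="m + l"])
    fix y :: "nat \<Rightarrow> real"
    let ?r = "1 + (\<Sum>i<n. \<bar>y i\<bar>)"
    have "\<bar>F y\<bar> \<le> C * ?r ^ (m + l)"
      using C(1) one_le_radius[of y n] by (intro order_trans[OF C(2)] mult_left_mono power_increasing) auto
    moreover have "\<bar>G y\<bar> \<le> D * ?r ^ (m + l)"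
      using D(1) one_le_radius[of y n] by (intro order_trans[OF D(2)] mult_left_mono power_increasing) auto
    ultimately show "\<bar>F y + G y\<bar> \<le> (C + D) * ?r ^ (m + l)"
      by (simp add: distrib_right)
  qed (use assms in \<open>auto intro!: continuous_intros dest: tame_continuous\<close>)
qed

lemma tame_mult:
  assumes "tame n F" "tame n G"
  shows "tame n (\<lambda>y. F y * G y)"
proof -
  obtain C m where C: "C \<ge> 1" "\<And>y. \<bar>F y\<bar> \<le> C * (1 + (\<Sum>i<n. \<bar>y i\<bar>)) ^ m"
    using tameE[OF assms(1)] by blast
  obtain D l where D: "D \<ge> 1" "\<And>y. \<bar>G y\<bar> \<le> D * (1 + (\<Sum>i<n. \<bar>y i\<bar>)) ^ l"
    using tameE[OF assms(2)] by blast
  show ?thesis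
  proof (rule tameI[where C="C * D" and m="m + l"])
    fix y :: "nat \<Rightarrow> real"
    have "\<bar>F y * G y\<bar> \<le> (C * (1 + (\<Sum>i<n. \<bar>y i\<bar>)) ^ m) * (D * (1 + (\<Sum>i<n. \<bar>y i\<bar>)) ^ l)"
      unfolding abs_mult using C D order_trans[OF abs_ge_zero C(2)] by (intro mult_mono) auto
    then show "\<bar>F y * G y\<bar> \<le> C * D * (1 + (\<Sum>i<n. \<bar>y i\<bar>)) ^ (m + l)"
      by (simp add: power_add mult_ac)
  qed (use assms in \<open>auto intro!: continuous_intros dest: tame_continuous\<close>)
qed

lemma tame_diff:
  assumes "tame n F" "tame n G" shows "tame n (\<lambda>y. F y - G y)"
  using tame_add[OF assms(1) tame_mult[OF tame_const[of n "-1"] assms(2)]] by simp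

lemma tame_sum: "(\<And>k. k \<in> A \<Longrightarrow> tame n (F k)) \<Longrightarrow> tame n (\<lambda>y. \<Sum>k\<in>A. F k y)"
  by (induction A rule: infinite_finite_induct) (auto intro: tame_const tame_add)

lemma tame_measurable: "tame n F \<Longrightarrow> F \<in> borel_measurable wiener"
  unfolding measurable_cong_sets[OF sets_wiener refl]
  by (intro borel_measurable_continuous_onI tame_continuous)

lemma integrable_wiener_coord_power: "integrable wiener (\<lambda>y. \<bar>y k\<bar> ^ m)"
proof -
  have "integrable std_normal_distribution (\<lambda>x. \<bar>x\<bar> ^ m)"
    using integrable_std_normal_moment_abs[of m] by (subst integrable_density) auto
  then have "integrable (distr wiener std_normal_distribution (\<lambda>y. y k)) (\<lambda>x. \<bar>x\<bar> ^ m)"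
    by (simp add: distr_wiener_coord)
  then show ?thesis by (subst (asm) integrable_distr_eq) auto
qed

lemma power_add_le_two_power:
  fixes u v :: real
  assumes "0 \<le> u" "0 \<le> v"
  shows "(u + v) ^ m \<le> 2 ^ m * (u ^ m + v ^ m)"
proof -
  have "(u + v) ^ m \<le> (2 * max u v) ^ m" using assms by (intro power_mono) auto
  also have "\<dots> = 2 ^ m * max u v ^ m" by (simp add: power_mult_distrib)
  also have "max u v ^ m \<le> u ^ m + v ^ m" using assms by (auto simp: max_def)
  finally show ?thesis by simp
qed

text \<open>Coordinates are split off one at a time by (u + v)^m \<le> 2^m (u^m + v^m), which
  reduces the claim to moments of single coordinates.\<close>

lemma integrable_wiener_radius_power: "integrable wiener (\<lambda>y. (1 + (\<Sum>i<n. \<bar>y i\<bar>)) ^ m)"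
proof (induction n)
  case (Suc n)
  have "integrable wiener (\<lambda>y. 2 ^ m * ((1 + (\<Sum>i<n. \<bar>y i\<bar>)) ^ m + \<bar>y n\<bar> ^ m))"
    using Suc integrable_wiener_coord_power by auto
  then show ?case
  proof (rule Bochner_Integration.integrable_bound, goal_cases)
    case 2
    have "\<bar>1 + (\<Sum>i<Suc n. \<bar>y i\<bar>)\<bar> ^ m \<le> 2 ^ m * ((1 + (\<Sum>i<n. \<bar>y i\<bar>)) ^ m + \<bar>y n\<bar> ^ m)" for y :: "nat \<Rightarrow> real"
      using power_add_le_two_power[OF radius_nonneg[of y n] abs_ge_zero[of "y n"], of m] radius_nonneg[of y "Suc n"]
      by (simp add: add.assoc)
    then show ?case
      using radius_nonneg by (intro AE_I2) (auto simp: power_abs[symmetric] intro: order_trans[OF _ abs_ge_self])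
  qed measurable
qed simp

lemma tame_integrable:
  assumes "tame n F" shows "integrable wiener F"
proof -
  obtain C m where C: "C \<ge> 1" "\<And>y. \<bar>F y\<bar> \<le> C * (1 + (\<Sum>i<n. \<bar>y i\<bar>)) ^ m"
    using tameE[OF assms(1)] by blast
  have "integrable wiener (\<lambda>y. C * (1 + (\<Sum>i<n. \<bar>y i\<bar>)) ^ m)"
    using integrable_wiener_radius_power by auto
  then show ?thesis
    by (rule Bochner_Integration.integrable_bound[OF _ tame_measurable[OF assms]])
       (use C in \<open>auto intro: order_trans[OF _ abs_ge_self]\<close>)
qed

lemma tame_Lp:
  assumes "tame n F" "p > 0" shows "F \<in> Lp_wiener p"
proof -
  obtain C m where C: "C \<ge> 1" "\<And>y. \<bar>F y\<bar> \<le> C * (1 + (\<Sum>i<n. \<bar>y i\<bar>)) ^ m"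
    using tameE[OF assms(1)] by blast
  obtain l where l: "p \<le> real l" using real_arch_simple by blast
  have [measurable]: "F \<in> borel_measurable wiener" using assms by (intro tame_measurable)
  have "integrable wiener (\<lambda>y. C ^ l * (1 + (\<Sum>i<n. \<bar>y i\<bar>)) ^ (m * l))"
    using integrable_wiener_radius_power by auto
  then have "integrable wiener (\<lambda>y. \<bar>F y\<bar> powr p)"
  proof (rule Bochner_Integration.integrable_bound)
    have "\<bar>F y\<bar> powr p \<le> C ^ l * (1 + (\<Sum>i<n. \<bar>y i\<bar>)) ^ (m * l)" for y
    proof -
      let ?r = "C * (1 + (\<Sum>i<n. \<bar>y i\<bar>)) ^ m"
      have r: "1 \<le> ?r"
        using C(1) one_le_power[OF one_le_radius[of y n], of m] mult_mono[of 1 C 1] by auto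
      have "\<bar>F y\<bar> powr p \<le> ?r powr p" using assms C by (intro powr_mono2) auto
      also have "\<dots> \<le> ?r powr (real l)" using r l by (intro powr_mono) auto
      also have "\<dots> = ?r ^ l" using r by (intro powr_realpow) auto
      also have "\<dots> = C ^ l * (1 + (\<Sum>i<n. \<bar>y i\<bar>)) ^ (m * l)"
        by (simp add: power_mult_distrib power_mult)
      finally show ?thesis .
    qed
    then show "AE y in wiener. norm (\<bar>F y\<bar> powr p) \<le> norm (C ^ l * (1 + (\<Sum>i<n. \<bar>y i\<bar>)) ^ (m * l))"
      by (auto intro: order_trans[OF _ abs_ge_self])
  qed measurable
  then show ?thesis by (simp add: Lp_wiener_def)
qed

section \<open>Partial derivatives and the class of smooth cylindrical functions\<close>

lemma iter_pd_Nil [simp]: "iter_pd [] F = F" and iter_pd_Cons [simp]: "iter_pd (k # ks) F = pd k (iter_pd ks F)"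
  by (simp_all add: iter_pd_def)

lemma iter_pd_pd: "iter_pd ks (pd k F) = iter_pd (ks @ [k]) F"
  by (simp add: iter_pd_def)

lemma depends_on_mono: "depends_on n F \<Longrightarrow> n \<le> n' \<Longrightarrow> depends_on n' F"
  unfolding depends_on_def by (meson order_less_le_trans)

lemma pd_eq_0:
  assumes "depends_on n F" "n \<le> k" shows "pd k F y = 0"
proof -
  have "(\<lambda>t. F (y(k := t))) = (\<lambda>t. F y)"
    using assms by (auto simp: depends_on_def fun_eq_iff)
  then show ?thesis by (simp add: pd_def)
qed

lemma depends_on_pd: assumes "depends_on n F" shows "depends_on n (pd k F)"
proof (cases "k < n")
  case True
  show ?thesis unfolding depends_on_def
  proof (intro allI impI)
    fix y z :: "nat \<Rightarrow> real" assume yz: "\<forall>i<n. y i = z i"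
    then have "F (y(k := t)) = F (z(k := t))" for t using assms by (auto simp: depends_on_def)
    then show "pd k F y = pd k F z" using yz True by (simp add: pd_def)
  qed
next
  case False
  then show ?thesis using pd_eq_0[OF assms] by (auto simp: depends_on_def)
qed

lemma smooth_in_mono: "smooth_in n F \<Longrightarrow> n \<le> n' \<Longrightarrow> smooth_in n' F"
  unfolding smooth_in_def using depends_on_mono tame_mono by blast

lemma smooth_in_pd: "smooth_in n F \<Longrightarrow> smooth_in n (pd k F)"
  unfolding smooth_in_def iter_pd_pd using depends_on_pd by blast

lemma smooth_in_depends: "smooth_in n F \<Longrightarrow> depends_on n F"
  by (simp add: smooth_in_def)

lemma smooth_in_tame: "smooth_in n F \<Longrightarrow> tame n F"
  unfolding smooth_in_def by (metis iter_pd_Nil)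

lemma smooth_in_differentiable: "smooth_in n F \<Longrightarrow> (\<lambda>t. F (y(k := t))) differentiable (at (y k))"
  unfolding smooth_in_def by (metis iter_pd_Nil)

text \<open>A class stable under every \<open>pd\<close> contains all iterated derivatives of its
  members, so regularity of all orders follows from first-order checks on the class.\<close>

lemma smooth_in_coinduct:
  assumes "F \<in> S"
    and S: "\<And>F. F \<in> S \<Longrightarrow> depends_on n F" "\<And>F. F \<in> S \<Longrightarrow> tame n F"
      "\<And>F k y. F \<in> S \<Longrightarrow> (\<lambda>t. F (y(k := t))) differentiable (at (y k))"
      "\<And>F k. F \<in> S \<Longrightarrow> pd k F \<in> S"
  shows "smooth_in n F"
proof -
  have "iter_pd ks F \<in> S" for ks
    by (induction ks) (use assms in auto)
  then show ?thesis unfolding smooth_in_def using S assms(1) by blast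
qed

lemma has_real_derivative_pd:
  assumes "\<And>y. (\<lambda>t. F (y(k := t))) differentiable (at (y k))"
  shows "((\<lambda>t. F (y(k := t))) has_real_derivative pd k F (y(k := t))) (at t)"
  using assms[of "y(k := t)"] by (simp add: pd_def DERIV_deriv_iff_real_differentiable)

lemma pd_eqI:
  "((\<lambda>t. F (y(k := t))) has_real_derivative d) (at (y k)) \<Longrightarrow> pd k F y = d"
  by (simp add: pd_def DERIV_imp_deriv)

lemma has_real_derivative_smooth_in:
  "smooth_in n F \<Longrightarrow> ((\<lambda>t. F (y(k := t))) has_real_derivative pd k F y) (at (y k))"
  using has_real_derivative_pd[of F k y "y k"] smooth_in_differentiable[of n F] by simp

lemma pd_diff:
  "smooth_in n F \<Longrightarrow> smooth_in n G \<Longrightarrow> pd k (\<lambda>y. F y - G y) = (\<lambda>y. pd k F y - pd k G y)"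
  by (intro ext pd_eqI derivative_intros has_real_derivative_smooth_in)

lemma smooth_in_diff:
  assumes "smooth_in n F" "smooth_in n G"
  shows "smooth_in n (\<lambda>y. F y - G y)"
proof (rule smooth_in_coinduct[where S="{H. \<exists>F G. H = (\<lambda>y. F y - G y) \<and> smooth_in n F \<and> smooth_in n G}"])
  show "(\<lambda>y. F y - G y) \<in> {H. \<exists>F G. H = (\<lambda>y. F y - G y) \<and> smooth_in n F \<and> smooth_in n G}"
    using assms by (intro CollectI exI[of _ F] exI[of _ G]) auto
next
  fix H assume "H \<in> {H. \<exists>F G. H = (\<lambda>y. F y - G y) \<and> smooth_in n F \<and> smooth_in n G}"
  then obtain F G where H: "H = (\<lambda>y. F y - G y)" and F: "smooth_in n F" and G: "smooth_in n G" by auto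
  show "depends_on n H"
    using smooth_in_depends[OF F] smooth_in_depends[OF G] unfolding H depends_on_def by metis
  show "tame n H" unfolding H by (intro tame_diff smooth_in_tame F G)
  show "(\<lambda>t. H (y(k := t))) differentiable (at (y k))" for k y
    unfolding H by (intro differentiable_diff smooth_in_differentiable[OF F] smooth_in_differentiable[OF G])
  show "pd k H \<in> {H. \<exists>F G. H = (\<lambda>y. F y - G y) \<and> smooth_in n F \<and> smooth_in n G}" for k
    unfolding H pd_diff[OF F G] using smooth_in_pd[OF F, of k] smooth_in_pd[OF G, of k]
    by (intro CollectI exI[of _ "pd k F"] exI[of _ "pd k G"]) auto
qed

section \<open>Gaussian integration by parts, on the line and on Wiener space\<close>

lemma std_normal_density_mult_power_tendsto_0:
  assumes "filterlim (\<lambda>x. \<bar>x\<bar>) at_top F"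
  shows "((\<lambda>x. std_normal_density x * (1 + \<bar>x\<bar>) ^ m) \<longlongrightarrow> 0) F"
proof (rule Lim_null_comparison)
  \<comment> \<open>Completing the square gives x^2/2 \<ge> (1 + |x|) - 3/2, whence the constant;
    the decay of u^m / exp u at u = 1 + |x| then finishes.\<close>
  let ?c = "1 / sqrt (2 * pi) * exp (3 / 2)"
  have "std_normal_density x \<le> ?c * (1 / exp (1 + \<bar>x\<bar>))" for x :: real
  proof -
    have "0 \<le> (\<bar>x\<bar> - 1)\<^sup>2" by simp
    then have "- x\<^sup>2 / 2 \<le> 3 / 2 + - (1 + \<bar>x\<bar>)" by (simp add: power2_eq_square algebra_simps)
    then have "exp (- x\<^sup>2 / 2) \<le> exp (3 / 2) * exp (- (1 + \<bar>x\<bar>))" by (simp only: exp_le_cancel_iff flip: exp_add)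
    then have "1 / sqrt (2 * pi) * exp (- x\<^sup>2 / 2) \<le> 1 / sqrt (2 * pi) * (exp (3 / 2) * exp (- (1 + \<bar>x\<bar>)))"
      by (intro mult_left_mono) auto
    moreover have "exp (- (1 + \<bar>x\<bar>)) = 1 / exp (1 + \<bar>x\<bar>)" by (simp only: exp_minus inverse_eq_divide)
    ultimately show ?thesis by (simp add: normal_density_def mult.commute)
  qed
  then have "std_normal_density x * (1 + \<bar>x\<bar>) ^ m \<le> ?c * (1 / exp (1 + \<bar>x\<bar>)) * (1 + \<bar>x\<bar>) ^ m" for x :: real
    by (intro mult_right_mono zero_le_power) auto
  then show "\<forall>\<^sub>F x in F. norm (std_normal_density x * (1 + \<bar>x\<bar>) ^ m) \<le> ?c * ((1 + \<bar>x\<bar>) ^ m / exp (1 + \<bar>x\<bar>))"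
    by (intro always_eventually allI) (simp add: abs_mult)
  have "filterlim (\<lambda>x. 1 + \<bar>x\<bar>) at_top F"
    using assms by (intro filterlim_tendsto_add_at_top[OF tendsto_const])
  from filterlim_compose[OF tendsto_power_div_exp_0 this]
  have "((\<lambda>x. ?c * ((1 + \<bar>x\<bar>) ^ m / exp (1 + \<bar>x\<bar>))) \<longlongrightarrow> ?c * 0) F"
    by (intro tendsto_intros)
  then show "((\<lambda>x. ?c * ((1 + \<bar>x\<bar>) ^ m / exp (1 + \<bar>x\<bar>))) \<longlongrightarrow> 0) F" by simp
qed

lemma integrable_std_normal_poly_bounded:
  assumes [measurable]: "f \<in> borel_measurable borel" and C: "\<And>x. \<bar>f x\<bar> \<le> C * (1 + \<bar>x\<bar>) ^ m"
  shows "integrable std_normal_distribution f"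
proof -
  have "integrable std_normal_distribution (\<lambda>x. \<bar>x\<bar> ^ m)" for m
    using integrable_std_normal_moment_abs[of m] by (subst integrable_density) auto
  then have "integrable std_normal_distribution (\<lambda>x. \<Sum>k\<le>m. of_nat (m choose k) * \<bar>x\<bar> ^ k)"
    by auto
  then have "integrable std_normal_distribution (\<lambda>x. C * (\<bar>x\<bar> + 1) ^ m)"
    by (simp add: binomial_ring)
  then show ?thesis
    by (rule Bochner_Integration.integrable_bound)
       (use C in \<open>auto simp: add.commute intro: order_trans[OF _ abs_ge_self]\<close>)
qed

text \<open>The integrand times the normal density is the derivative of density times f, which
  vanishes at both infinities because f grows polynomially.\<close>

lemma gaussian_integration_by_parts:
  fixes f f' :: "real \<Rightarrow> real"
  assumes deriv: "\<And>x. (f has_real_derivative f' x) (at x)" and cont: "continuous_on UNIV f'"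
    and f: "\<And>x. \<bar>f x\<bar> \<le> C * (1 + \<bar>x\<bar>) ^ m" and f': "\<And>x. \<bar>f' x\<bar> \<le> D * (1 + \<bar>x\<bar>) ^ l"
  shows "(\<integral>x. f' x - x * f x \<partial>std_normal_distribution) = 0"
proof -
  let ?\<phi> = "std_normal_density"
  let ?h = "\<lambda>x. ?\<phi> x * (f' x - x * f x)"
  have cf: "continuous_on UNIV f"
    using deriv by (meson DERIV_continuous continuous_at_imp_continuous_on)
  have [measurable]: "f \<in> borel_measurable borel" "f' \<in> borel_measurable borel"
    using cf cont by (auto intro: borel_measurable_continuous_onI)
  have "integrable std_normal_distribution f'"
    by (rule integrable_std_normal_poly_bounded[OF _ f']) auto
  moreover have "integrable std_normal_distribution (\<lambda>x. x * f x)"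
  proof (rule integrable_std_normal_poly_bounded)
    fix x :: real
    have "\<bar>x * f x\<bar> \<le> (1 + \<bar>x\<bar>) * (C * (1 + \<bar>x\<bar>) ^ m)"
      unfolding abs_mult using f[of x] by (intro mult_mono) auto
    then show "\<bar>x * f x\<bar> \<le> C * (1 + \<bar>x\<bar>) ^ (Suc m)" by (simp add: mult_ac)
  qed auto
  ultimately have "integrable std_normal_distribution (\<lambda>x. f' x - x * f x)" by auto
  then have int: "integrable lborel ?h"
    by (subst (asm) integrable_density) auto
  have lim: "((\<lambda>x. ?\<phi> x * f x) \<longlongrightarrow> 0) F" if F: "filterlim (\<lambda>x. \<bar>x\<bar>) at_top F" for F
  proof (rule Lim_null_comparison)
    show "\<forall>\<^sub>F x in F. norm (?\<phi> x * f x) \<le> C * (?\<phi> x * (1 + \<bar>x\<bar>) ^ m)"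
      using f by (intro always_eventually allI) (auto simp: abs_mult mult.left_commute[of C] intro!: mult_left_mono)
    have "((\<lambda>x. C * (?\<phi> x * (1 + \<bar>x\<bar>) ^ m)) \<longlongrightarrow> C * 0) F"
      by (intro tendsto_intros std_normal_density_mult_power_tendsto_0 F)
    then show "((\<lambda>x. C * (?\<phi> x * (1 + \<bar>x\<bar>) ^ m)) \<longlongrightarrow> 0) F" by simp
  qed
  have "(LBINT x=-\<infinity>..\<infinity>. ?h x) = 0 - 0"
  proof (rule interval_integral_FTC_integrable[where F="\<lambda>x. ?\<phi> x * f x"])
    fix x :: real
    have "(?\<phi> has_real_derivative - x * ?\<phi> x) (at x)"
      unfolding normal_density_def by (auto intro!: derivative_eq_intros simp: field_simps)
    then have "((\<lambda>x. ?\<phi> x * f x) has_real_derivative ?h x) (at x)"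
      by (auto intro!: derivative_eq_intros deriv simp: algebra_simps)
    then show "((\<lambda>x. ?\<phi> x * f x) has_vector_derivative ?h x) (at x)"
      by (simp add: has_real_derivative_iff_has_vector_derivative)
    have "continuous_on UNIV ?h"
      unfolding normal_density_def by (intro continuous_intros cf cont) auto
    then show "isCont ?h x" by (simp add: continuous_on_eq_continuous_at)
  next
    show "set_integrable lborel (einterval (- \<infinity>) \<infinity>) ?h"
      using int by (simp add: set_integrable_def)
    show "(((\<lambda>x. ?\<phi> x * f x) \<circ> real_of_ereal) \<longlongrightarrow> 0) (at_right (- \<infinity>))"
      unfolding ereal_tendsto_simps by (rule lim) real_asymp
    show "(((\<lambda>x. ?\<phi> x * f x) \<circ> real_of_ereal) \<longlongrightarrow> 0) (at_left \<infinity>)"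
      unfolding ereal_tendsto_simps by (rule lim) real_asymp
  qed simp
  then have "(\<integral>x. ?h x \<partial>lborel) = 0" by (simp add: interval_lebesgue_integral_def set_lebesgue_integral_def)
  then show ?thesis by (subst integral_density) auto
qed

text \<open>With r the value of 1 + |y_0| + ... + |y_(n-1)|, the bound r + |t| \<le> r (1 + |t|)
  holds as r \<ge> 1. The constant depends on y, which is enough to integrate by parts on each line
  separately.\<close>

lemma tame_line_bound:
  assumes "tame n F"
  obtains D m where "\<And>t. \<bar>F (y(k := t))\<bar> \<le> D * (1 + \<bar>t\<bar>) ^ m"
proof -
  obtain C m where C: "C \<ge> 1" "\<And>y. \<bar>F y\<bar> \<le> C * (1 + (\<Sum>i<n. \<bar>y i\<bar>)) ^ m"
    using tameE[OF assms(1)] by blast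
  let ?r = "1 + (\<Sum>i<n. \<bar>y i\<bar>)"
  have "\<bar>F (y(k := t))\<bar> \<le> (C * ?r ^ m) * (1 + \<bar>t\<bar>) ^ m" for t
  proof -
    have "(\<Sum>i<n. \<bar>(y(k := t)) i\<bar>) \<le> (\<Sum>i<n. \<bar>y i\<bar> + (if i = k then \<bar>t\<bar> else 0))"
      by (intro sum_mono) auto
    also have "\<dots> \<le> (\<Sum>i<n. \<bar>y i\<bar>) + \<bar>t\<bar>" by (simp add: sum.distrib)
    finally have "1 + (\<Sum>i<n. \<bar>(y(k := t)) i\<bar>) \<le> ?r + \<bar>t\<bar>" by simp
    also have "\<dots> \<le> ?r + \<bar>t\<bar> * ?r"
      using mult_left_mono[OF one_le_radius[of y n], of "\<bar>t\<bar>"] by simp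
    also have "\<dots> = ?r * (1 + \<bar>t\<bar>)" by (simp add: algebra_simps)
    finally have "(1 + (\<Sum>i<n. \<bar>(y(k := t)) i\<bar>)) ^ m \<le> (?r * (1 + \<bar>t\<bar>)) ^ m"
      by (intro power_mono radius_nonneg)
    then have "C * (1 + (\<Sum>i<n. \<bar>(y(k := t)) i\<bar>)) ^ m \<le> C * (?r * (1 + \<bar>t\<bar>)) ^ m"
      using C(1) by (intro mult_left_mono) auto
    with C(2)[of "y(k := t)"] show ?thesis by (simp add: power_mult_distrib mult.assoc)
  qed
  then show thesis by (rule that)
qed

lemma continuous_on_line:
  fixes F :: "(nat \<Rightarrow> real) \<Rightarrow> real"
  assumes "continuous_on UNIV F" shows "continuous_on UNIV (\<lambda>t. F (y(k := t)))"
proof (rule continuous_on_compose2[OF assms])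
  show "continuous_on UNIV (\<lambda>t. y(k := t))"
  proof (rule continuous_on_coordinatewise_then_product)
    show "continuous_on UNIV (\<lambda>t. (y(k := t)) i)" for i
      by (cases "i = k") (auto intro!: continuous_intros)
  qed
qed auto

text \<open>Resampling one coordinate leaves the Wiener measure invariant.\<close>

lemma wiener_integral_eq_0:
  fixes G :: "(nat \<Rightarrow> real) \<Rightarrow> real"
  assumes int: "integrable wiener G"
    and zero: "\<And>y. (\<integral>t. G (y(k := t)) \<partial>std_normal_distribution) = 0"
  shows "(\<integral>y. G y \<partial>wiener) = 0"
proof -
  let ?N = "std_normal_distribution"
  let ?W = "\<Pi>\<^sub>M i\<in>UNIV - {k}. ?N"
  interpret N: prob_space ?N by (rule prob_space_normal_density) simp
  interpret W: prob_space ?W by (intro prob_space_PiM N.prob_space_axioms)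
  interpret P: pair_sigma_finite ?N ?W ..
  have ins: "insert k (UNIV - {k}) = UNIV" by auto
  have D: "distr (?N \<Otimes>\<^sub>M ?W) wiener (\<lambda>(x, X). X(k := x)) = wiener"
    using distr_pair_PiM_eq_PiM[of "UNIV - {k}" "\<lambda>_. ?N" k] N.prob_space_axioms
    unfolding wiener_def ins by simp
  have M: "(\<lambda>(x, X). X(k := x)) \<in> ?N \<Otimes>\<^sub>M ?W \<rightarrow>\<^sub>M wiener"
  proof -
    have "(\<lambda>(x, X). X(k := x)) \<in> ?N \<Otimes>\<^sub>M ?W \<rightarrow>\<^sub>M (\<Pi>\<^sub>M i\<in>insert k (UNIV - {k}). ?N)"
      unfolding split_beta by (rule measurable_fun_upd[where J="UNIV - {k}"]) auto
    then show ?thesis unfolding wiener_def ins .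
  qed
  have G: "G \<in> borel_measurable wiener" using int by auto
  have i: "integrable (?N \<Otimes>\<^sub>M ?W) (\<lambda>(x, X). G (X(k := x)))"
  proof -
    have "integrable (distr (?N \<Otimes>\<^sub>M ?W) wiener (\<lambda>(x, X). X(k := x))) G" unfolding D by (rule int)
    then show ?thesis by (subst (asm) integrable_distr_eq[OF M G]) (simp add: case_prod_unfold)
  qed
  have "(\<integral>y. G y \<partial>wiener) = (\<integral>y. G y \<partial>distr (?N \<Otimes>\<^sub>M ?W) wiener (\<lambda>(x, X). X(k := x)))"
    unfolding D ..
  also have "\<dots> = (\<integral>z. (case z of (x, X) \<Rightarrow> G (X(k := x))) \<partial>(?N \<Otimes>\<^sub>M ?W))"
    by (subst integral_distr[OF M G]) (simp add: case_prod_unfold)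
  also have "\<dots> = (\<integral>X. (\<integral>x. G (X(k := x)) \<partial>?N) \<partial>?W)"
    using P.integral_snd[OF i] by simp
  also have "\<dots> = 0" by (simp add: zero)
  finally show ?thesis .
qed

lemma wiener_integration_by_parts:
  assumes F: "tame n F" and dF: "tame n (pd k F)"
    and diff: "\<And>y. (\<lambda>t. F (y(k := t))) differentiable (at (y k))"
  shows "(\<integral>y. pd k F y \<partial>wiener) = (\<integral>y. y k * F y \<partial>wiener)"
proof -
  \<comment> \<open>Direction k may lie beyond the first n coordinates; the enlargement makes
    \<open>y k\<close> tame as well.\<close>
  let ?n = "max n (Suc k)"
  have t: "tame ?n (pd k F)" "tame ?n (\<lambda>y. y k * F y)"
    using F dF by (auto intro!: tame_mult tame_coord intro: tame_mono)
  then have i: "integrable wiener (pd k F)" "integrable wiener (\<lambda>y. y k * F y)"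
    by (auto intro: tame_integrable)
  have "(\<integral>y. pd k F y - y k * F y \<partial>wiener) = 0"
  proof (rule wiener_integral_eq_0[where k=k])
    fix y :: "nat \<Rightarrow> real"
    obtain C m where C: "\<And>t. \<bar>F (y(k := t))\<bar> \<le> C * (1 + \<bar>t\<bar>) ^ m"
      using tame_line_bound[OF F] by blast
    obtain D l where D: "\<And>t. \<bar>pd k F (y(k := t))\<bar> \<le> D * (1 + \<bar>t\<bar>) ^ l"
      using tame_line_bound[OF dF] by blast
    show "(\<integral>t. pd k F (y(k := t)) - (y(k := t)) k * F (y(k := t)) \<partial>std_normal_distribution) = 0"
      using gaussian_integration_by_parts[where f="\<lambda>t. F (y(k := t))" and f'="\<lambda>t. pd k F (y(k := t))",
          OF has_real_derivative_pd[OF diff] continuous_on_line[OF tame_continuous[OF dF]] C D]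
      by simp
  qed (use i in auto)
  then show ?thesis using i by simp
qed

section \<open>The energy form and the Ornstein-Uhlenbeck operator on cylindrical functions\<close>

definition energy :: "((nat \<Rightarrow> real) \<Rightarrow> real) \<Rightarrow> ((nat \<Rightarrow> real) \<Rightarrow> real) \<Rightarrow> real" where
  "energy F G = (\<integral>y. carre_cyl F G y \<partial>wiener)"

text \<open>The cut at n is exact for functions of the first n coordinates, whose remaining partial
  derivatives vanish.\<close>

definition ornstein_uhlenbeck :: "nat \<Rightarrow> ((nat \<Rightarrow> real) \<Rightarrow> real) \<Rightarrow> (nat \<Rightarrow> real) \<Rightarrow> real" where
  "ornstein_uhlenbeck n F y = (\<Sum>k<n. pd k (pd k F) y - y k * pd k F y)"

lemma carre_cyl_commute: "carre_cyl F G = carre_cyl G F"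
  by (simp add: carre_cyl_def fun_eq_iff mult.commute)

lemma carre_cyl_eq_sum:
  assumes "depends_on n F \<or> depends_on n G"
  shows "carre_cyl F G y = (\<Sum>k<n. pd k F y * pd k G y)"
  unfolding carre_cyl_def using assms by (intro suminf_finite) (auto simp: pd_eq_0 not_less)

lemma tame_carre_cyl:
  assumes "smooth_in n F" "smooth_in n G" shows "tame n (carre_cyl F G)"
proof -
  have "carre_cyl F G = (\<lambda>y. \<Sum>k<n. pd k F y * pd k G y)"
    using carre_cyl_eq_sum smooth_in_depends[OF assms(1)] by blast
  then show ?thesis
    using assms by (auto intro!: tame_sum tame_mult intro: smooth_in_tame[OF smooth_in_pd])
qed

lemma tame_ornstein_uhlenbeck: "smooth_in n F \<Longrightarrow> tame n (ornstein_uhlenbeck n F)"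
  unfolding ornstein_uhlenbeck_def[abs_def]
  by (intro tame_sum tame_diff tame_mult smooth_in_tame smooth_in_pd tame_coord) auto

lemma pd_mult:
  assumes "smooth_in n F" "smooth_in n G"
  shows "pd k (\<lambda>y. F y * G y) y = pd k F y * G y + F y * pd k G y"
  using assms
  by (intro pd_eqI) (auto intro!: derivative_eq_intros has_real_derivative_smooth_in)

text \<open>Integrating by parts the product F (pd k G) in each direction k < n takes the derivative
  off F. Although F may involve more than n coordinates, the sum stops at n because G has no further
  derivatives; \<open>m\<close> only provides a common growth bound.\<close>

lemma energy_eq_ornstein_uhlenbeck:
  assumes F: "smooth_in l F" and G: "smooth_in n G"
  shows "energy F G = - (\<integral>y. F y * ornstein_uhlenbeck n G y \<partial>wiener)"
proof -
  define m where "m = max l n"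
  have F': "smooth_in m F" and G': "smooth_in m G"
    using F G smooth_in_mono by (auto simp: m_def)
  note tame = smooth_in_tame[OF F'] smooth_in_tame[OF smooth_in_pd[OF F']]
    smooth_in_tame[OF smooth_in_pd[OF G']] smooth_in_tame[OF smooth_in_pd[OF smooth_in_pd[OF G']]]
  have int1: "integrable wiener (\<lambda>y. pd k F y * pd k G y)" for k
    by (intro tame_integrable[of m] tame_mult tame)
  have int2: "integrable wiener (\<lambda>y. F y * (pd k (pd k G) y - y k * pd k G y))" if "k < n" for k
    using that by (intro tame_integrable[of m] tame_mult tame_diff tame tame_coord) (auto simp: m_def)
  have k: "(\<integral>y. pd k F y * pd k G y \<partial>wiener) = - (\<integral>y. F y * (pd k (pd k G) y - y k * pd k G y) \<partial>wiener)" if "k < n" for k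
  proof -
    let ?H = "\<lambda>y. F y * pd k G y"
    have pdH: "pd k ?H = (\<lambda>y. pd k F y * pd k G y + F y * pd k (pd k G) y)"
      by (rule ext) (rule pd_mult[OF F' smooth_in_pd[OF G']])
    have "(\<integral>y. pd k ?H y \<partial>wiener) = (\<integral>y. y k * ?H y \<partial>wiener)"
    proof (rule wiener_integration_by_parts)
      show "tame m ?H" by (intro tame_mult tame)
      show "tame m (pd k ?H)" unfolding pdH by (intro tame_add tame_mult tame)
      show "(\<lambda>t. ?H (y(k := t))) differentiable (at (y k))" for y
        by (intro derivative_intros smooth_in_differentiable[OF F'] smooth_in_differentiable[OF smooth_in_pd[OF G']])
    qed
    moreover have "integrable wiener (\<lambda>y. pd k F y * pd k G y)" "integrable wiener (\<lambda>y. F y * pd k (pd k G) y)"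
      by (intro tame_integrable[of m] tame_mult tame)+
    moreover have "integrable wiener (\<lambda>y. y k * (F y * pd k G y))"
      using that by (intro tame_integrable[of m] tame_mult tame tame_coord) (auto simp: m_def)
    ultimately show ?thesis
      by (simp add: pdH right_diff_distrib mult.left_commute)
  qed
  have "energy F G = (\<Sum>k<n. \<integral>y. pd k F y * pd k G y \<partial>wiener)"
    unfolding energy_def carre_cyl_eq_sum[OF disjI2[OF smooth_in_depends[OF G]]]
    by (rule Bochner_Integration.integral_sum) (rule int1)
  also have "\<dots> = - (\<Sum>k<n. \<integral>y. F y * (pd k (pd k G) y - y k * pd k G y) \<partial>wiener)"
    by (simp add: k sum_negf)
  also have "\<dots> = - (\<integral>y. F y * ornstein_uhlenbeck n G y \<partial>wiener)"
    unfolding ornstein_uhlenbeck_def sum_distrib_left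
    by (subst Bochner_Integration.integral_sum) (auto simp: int2)
  finally show ?thesis .
qed

lemma integrable_carre_cyl:
  assumes "F \<in> smooth_cyl" "G \<in> smooth_cyl" shows "integrable wiener (carre_cyl F G)"
proof -
  obtain m n where "smooth_in m F" "smooth_in n G" using assms by (auto simp: smooth_cyl_iff)
  then have "smooth_in (max m n) F" "smooth_in (max m n) G" by (auto intro: smooth_in_mono)
  then show ?thesis by (intro tame_integrable tame_carre_cyl)
qed

lemma smooth_cyl_diff:
  assumes "F \<in> smooth_cyl" "G \<in> smooth_cyl" shows "(\<lambda>y. F y - G y) \<in> smooth_cyl"
proof -
  obtain m n where "smooth_in m F" "smooth_in n G" using assms by (auto simp: smooth_cyl_iff)
  then have "smooth_in (max m n) F" "smooth_in (max m n) G" by (auto intro: smooth_in_mono)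
  then show ?thesis unfolding smooth_cyl_iff by (blast intro: smooth_in_diff)
qed

lemma carre_cyl_diff_left:
  assumes "F \<in> smooth_cyl" "G \<in> smooth_cyl" "H \<in> smooth_cyl"
  shows "carre_cyl (\<lambda>y. F y - G y) H y = carre_cyl F H y - carre_cyl G H y"
proof -
  obtain m n l where s: "smooth_in m F" "smooth_in n G" "smooth_in l H"
    using assms by (auto simp: smooth_cyl_iff)
  then have "smooth_in (max m n) F" "smooth_in (max m n) G" by (auto intro: smooth_in_mono)
  then show ?thesis
    using smooth_in_depends[OF s(3)] by (simp add: carre_cyl_eq_sum[of l] pd_diff left_diff_distrib sum_subtractf)
qed

lemma energy_diff_left:
  assumes "F \<in> smooth_cyl" "G \<in> smooth_cyl" "H \<in> smooth_cyl"
  shows "energy (\<lambda>y. F y - G y) H = energy F H - energy G H"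
  using assms by (simp add: energy_def carre_cyl_diff_left integrable_carre_cyl)

lemma energy_commute: "energy F G = energy G F"
  by (simp add: energy_def carre_cyl_commute)

lemma carre_cyl_nonneg: assumes "F \<in> smooth_cyl" shows "0 \<le> carre_cyl F F y"
proof -
  obtain n where "depends_on n F" using assms smooth_in_depends by (auto simp: smooth_cyl_iff)
  then show ?thesis by (simp add: carre_cyl_eq_sum sum_nonneg)
qed

lemma energy_nonneg: "F \<in> smooth_cyl \<Longrightarrow> 0 \<le> energy F F"
  by (simp add: energy_def carre_cyl_nonneg)

lemma energy_diff_self:
  assumes "F \<in> smooth_cyl" "G \<in> smooth_cyl"
  shows "energy (\<lambda>y. F y - G y) (\<lambda>y. F y - G y) = energy F F - 2 * energy F G + energy G G"
proof -
  let ?D = "\<lambda>y. F y - G y"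
  have "energy ?D ?D = energy F ?D - energy G ?D"
    by (intro energy_diff_left smooth_cyl_diff assms)
  also have "energy F ?D = energy F F - energy F G"
    using energy_diff_left[OF assms assms(1)] energy_commute[of F] by metis
  also have "energy G ?D = energy F G - energy G G"
    using energy_diff_left[OF assms assms(2)] energy_commute[of G] by metis
  finally show ?thesis by simp
qed

section \<open>Cauchy-Schwarz inequalities for the energy and in L^2\<close>

lemma discriminant_le_if_nonneg:
  fixes a b c :: real
  assumes "\<And>t. 0 \<le> a + 2 * t * b + t\<^sup>2 * c"
  shows "b\<^sup>2 \<le> a * c"
proof (cases "c = 0")
  case True
  have "b = 0"
  proof (rule ccontr)
    assume "b \<noteq> 0"
    \<comment> \<open>At this point the expression, linear because c = 0, has the value -1.\<close>
    then show False using assms[of "- (a + 1) / (2 * b)"] True by (simp add: field_simps)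
  qed
  then show ?thesis using True by simp
next
  case False
  have "c > 0"
  proof (rule ccontr)
    assume "\<not> c > 0"
    with False have c: "c < 0" by simp
    \<comment> \<open>Large enough for the negative quadratic term to outweigh the others: the whole
      expression is then at most t c < 0.\<close>
    define t where "t = 1 + (\<bar>a\<bar> + 2 * \<bar>b\<bar>) / (- c)"
    have t: "t \<ge> 1" "- c * t = - c + \<bar>a\<bar> + 2 * \<bar>b\<bar>" using c by (simp_all add: t_def field_simps)
    have "a \<le> t * \<bar>a\<bar>" using mult_right_mono[OF t(1), of "\<bar>a\<bar>"] by simp
    moreover have "2 * t * b \<le> t * (2 * \<bar>b\<bar>)" using t(1) mult_left_mono[of "2 * b" "2 * \<bar>b\<bar>" t] by simp
    moreover have "t\<^sup>2 * c = - (t * (- c + \<bar>a\<bar> + 2 * \<bar>b\<bar>))" unfolding t(2)[symmetric] by (simp add: power2_eq_square)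
    ultimately have "a + 2 * t * b + t\<^sup>2 * c \<le> t * c" by (simp add: algebra_simps)
    also have "t * c < 0" using t c by (simp add: mult_pos_neg)
    finally show False using assms[of t] by simp
  qed
  have "0 \<le> a + 2 * (- b / c) * b + (- b / c)\<^sup>2 * c" by (rule assms)
  also have "\<dots> = a - b\<^sup>2 / c" using \<open>c > 0\<close> by (simp add: power2_eq_square field_simps)
  finally show ?thesis using \<open>c > 0\<close> by (simp add: field_simps)
qed

text \<open>Summing (pd k F + t pd k G)^2 over k and integrating gives a nonnegative quadratic in t.
  The energy is only semidefinite (constants have energy 0), which is why
  \<open>discriminant_le_if_nonneg\<close> covers c = 0.\<close>

lemma energy_Cauchy_Schwarz:
  assumes "F \<in> smooth_cyl" "G \<in> smooth_cyl"
  shows "(energy F G)\<^sup>2 \<le> energy F F * energy G G"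
proof (rule discriminant_le_if_nonneg)
  fix t :: real
  obtain m n where s: "smooth_in m F" "smooth_in n G" using assms by (auto simp: smooth_cyl_iff)
  have d: "depends_on (max m n) F" "depends_on (max m n) G"
    using s by (auto intro!: smooth_in_depends intro: smooth_in_mono)
  note i = integrable_carre_cyl[OF assms(1) assms(1)] integrable_carre_cyl[OF assms(1) assms(2)] integrable_carre_cyl[OF assms(2) assms(2)]
  have "0 \<le> (\<integral>y. carre_cyl F F y + 2 * t * carre_cyl F G y + t\<^sup>2 * carre_cyl G G y \<partial>wiener)"
  proof (intro Bochner_Integration.integral_nonneg)
    fix y
    have "0 \<le> (\<Sum>k<max m n. (pd k F y + t * pd k G y)\<^sup>2)" by (intro sum_nonneg) simp
    also have "\<dots> = carre_cyl F F y + 2 * t * carre_cyl F G y + t\<^sup>2 * carre_cyl G G y"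
      using d by (simp add: carre_cyl_eq_sum[of "max m n"] sum_distrib_left sum.distrib[symmetric] power2_eq_square algebra_simps)
    finally show "0 \<le> carre_cyl F F y + 2 * t * carre_cyl F G y + t\<^sup>2 * carre_cyl G G y" .
  qed
  also have "\<dots> = energy F F + 2 * t * energy F G + t\<^sup>2 * energy G G"
    using i by (simp add: energy_def)
  finally show "0 \<le> energy F F + 2 * t * energy F G + t\<^sup>2 * energy G G" .
qed

lemma integral_Cauchy_Schwarz:
  fixes f g :: "'a \<Rightarrow> real"
  assumes [measurable]: "f \<in> borel_measurable M" "g \<in> borel_measurable M"
    and i: "integrable M (\<lambda>x. (f x)\<^sup>2)" "integrable M (\<lambda>x. (g x)\<^sup>2)"
  shows "integrable M (\<lambda>x. f x * g x)"
    and "(\<integral>x. f x * g x \<partial>M)\<^sup>2 \<le> (\<integral>x. (f x)\<^sup>2 \<partial>M) * (\<integral>x. (g x)\<^sup>2 \<partial>M)"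
proof -
  have "integrable M (\<lambda>x. (f x)\<^sup>2 + (g x)\<^sup>2)" using i by auto
  then show fg: "integrable M (\<lambda>x. f x * g x)"
  proof (rule Bochner_Integration.integrable_bound)
    have "\<bar>f x * g x\<bar> \<le> (f x)\<^sup>2 + (g x)\<^sup>2" for x
    proof -
      have "2 * (\<bar>f x\<bar> * \<bar>g x\<bar>) \<le> (f x)\<^sup>2 + (g x)\<^sup>2"
        using sum_squares_bound[of "\<bar>f x\<bar>" "\<bar>g x\<bar>"] by (simp add: mult.assoc)
      moreover have "0 \<le> \<bar>f x\<bar> * \<bar>g x\<bar>" by simp
      ultimately show ?thesis unfolding abs_mult by linarith
    qed
    then show "AE x in M. norm (f x * g x) \<le> norm ((f x)\<^sup>2 + (g x)\<^sup>2)" by simp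
  qed measurable
  show "(\<integral>x. f x * g x \<partial>M)\<^sup>2 \<le> (\<integral>x. (f x)\<^sup>2 \<partial>M) * (\<integral>x. (g x)\<^sup>2 \<partial>M)"
  proof (rule discriminant_le_if_nonneg)
    fix t :: real
    have "0 \<le> (\<integral>x. (f x + t * g x)\<^sup>2 \<partial>M)" by simp
    also have "\<dots> = (\<integral>x. (f x)\<^sup>2 + 2 * t * (f x * g x) + t\<^sup>2 * (g x)\<^sup>2 \<partial>M)"
      by (intro Bochner_Integration.integral_cong) (auto simp: power2_eq_square algebra_simps)
    also have "\<dots> = (\<integral>x. (f x)\<^sup>2 \<partial>M) + 2 * t * (\<integral>x. f x * g x \<partial>M) + t\<^sup>2 * (\<integral>x. (g x)\<^sup>2 \<partial>M)"
      using i fg by simp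
    finally show "0 \<le> (\<integral>x. (f x)\<^sup>2 \<partial>M) + 2 * t * (\<integral>x. f x * g x \<partial>M) + t\<^sup>2 * (\<integral>x. (g x)\<^sup>2 \<partial>M)" .
  qed
qed

lemma tendsto_integral_mult_L2:
  fixes f :: "nat \<Rightarrow> 'a \<Rightarrow> real"
  assumes m: "\<And>n. f n \<in> borel_measurable M" "g \<in> borel_measurable M"
    and i: "\<And>n. integrable M (\<lambda>x. (f n x)\<^sup>2)" "integrable M (\<lambda>x. (g x)\<^sup>2)"
    and lim: "(\<lambda>n. \<integral>x. (f n x)\<^sup>2 \<partial>M) \<longlonglongrightarrow> 0"
  shows "(\<lambda>n. \<integral>x. f n x * g x \<partial>M) \<longlonglongrightarrow> 0"
proof -
  have "(\<lambda>n. (\<integral>x. f n x * g x \<partial>M)\<^sup>2) \<longlonglongrightarrow> 0"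
  proof (rule Lim_null_comparison)
    show "\<forall>\<^sub>F n in sequentially. norm ((\<integral>x. f n x * g x \<partial>M)\<^sup>2) \<le> (\<integral>x. (f n x)\<^sup>2 \<partial>M) * (\<integral>x. (g x)\<^sup>2 \<partial>M)"
      using integral_Cauchy_Schwarz(2)[OF m i] by simp
    show "(\<lambda>n. (\<integral>x. (f n x)\<^sup>2 \<partial>M) * (\<integral>x. (g x)\<^sup>2 \<partial>M)) \<longlonglongrightarrow> 0"
      using tendsto_mult[OF lim tendsto_const, of "\<integral>x. (g x)\<^sup>2 \<partial>M"] by simp
  qed
  then show ?thesis by (rule power_tendsto_0_iff[THEN iffD1, rotated]) simp
qed

lemma Lp_wiener_2_iff: "F \<in> Lp_wiener 2 \<longleftrightarrow> F \<in> borel_measurable wiener \<and> integrable wiener (\<lambda>y. (F y)\<^sup>2)"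
  by (simp add: Lp_wiener_def)

lemma Lp_wiener_2_diff:
  assumes "F \<in> Lp_wiener 2" "G \<in> Lp_wiener 2" shows "(\<lambda>y. F y - G y) \<in> Lp_wiener 2"
proof -
  have [measurable]: "F \<in> borel_measurable wiener" "G \<in> borel_measurable wiener"
    and i: "integrable wiener (\<lambda>y. (F y)\<^sup>2)" "integrable wiener (\<lambda>y. (G y)\<^sup>2)"
    using assms by (auto simp: Lp_wiener_2_iff)
  have "integrable wiener (\<lambda>y. (F y)\<^sup>2 - 2 * (F y * G y) + (G y)\<^sup>2)"
    using i integral_Cauchy_Schwarz(1)[OF _ _ i] by auto
  then have "integrable wiener (\<lambda>y. (F y - G y)\<^sup>2)" by (simp add: power2_diff algebra_simps)
  then show ?thesis by (simp add: Lp_wiener_2_iff)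
qed

lemma smooth_cyl_Lp: "F \<in> smooth_cyl \<Longrightarrow> p > 0 \<Longrightarrow> F \<in> Lp_wiener p"
  by (auto simp: smooth_cyl_iff intro: tame_Lp[OF smooth_in_tame])

section \<open>Closability of the form and identification of the generator\<close>

lemma energy_closable:
  assumes V: "\<And>n. V n \<in> smooth_cyl"
    and L2: "(\<lambda>n. \<integral>y. (V n y)\<^sup>2 \<partial>wiener) \<longlonglongrightarrow> 0"
    and Cauchy: "\<And>e. e > 0 \<Longrightarrow> \<exists>N. \<forall>m\<ge>N. \<forall>n\<ge>N. energy (\<lambda>y. V m y - V n y) (\<lambda>y. V m y - V n y) < e"
  shows "(\<lambda>n. energy (V n) (V n)) \<longlonglongrightarrow> 0"
proof (rule LIMSEQ_I)
  fix e :: real assume "e > 0"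
  then obtain N where N: "\<And>m n. m \<ge> N \<Longrightarrow> n \<ge> N \<Longrightarrow> energy (\<lambda>y. V m y - V n y) (\<lambda>y. V m y - V n y) < e / 2"
    using Cauchy[of "e / 2"] by auto
  \<comment> \<open>For fixed m the mixed energy of V n and V m is an L^2 pairing of V n with the
    fixed function \<open>?L\<close>, so it tends to 0 with n. Since the energy of V m - V n is at
    least that of V m minus twice the mixed term, letting n grow passes the Cauchy bound on to V m
    itself.\<close>
  have small: "energy (V m) (V m) \<le> e / 2" if m: "m \<ge> N" for m
  proof -
    obtain l where l: "smooth_in l (V m)" using V smooth_cyl_iff by blast
    let ?L = "ornstein_uhlenbeck l (V m)"
    have "(\<lambda>n. \<integral>y. V n y * ?L y \<partial>wiener) \<longlonglongrightarrow> 0"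
      using smooth_cyl_Lp[OF V, of 2] tame_Lp[OF tame_ornstein_uhlenbeck[OF l], of 2] L2
      by (intro tendsto_integral_mult_L2) (auto simp: Lp_wiener_2_iff)
    moreover have "energy (V n) (V m) = - (\<integral>y. V n y * ?L y \<partial>wiener)" for n
    proof -
      obtain l' where "smooth_in l' (V n)" using V smooth_cyl_iff by blast
      then show ?thesis using l by (rule energy_eq_ornstein_uhlenbeck)
    qed
    ultimately have lim: "(\<lambda>n. energy (V n) (V m)) \<longlonglongrightarrow> 0"
      by (simp only: tendsto_minus_cancel_left[symmetric] minus_zero)
    have "energy (V m) (V m) - 2 * energy (V n) (V m) \<le> e / 2" if n: "n \<ge> N" for n
      using N[OF m n] energy_diff_self[OF V V, of m n] energy_nonneg[OF V, of n] energy_commute[of "V n" "V m"]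
      by linarith
    then have "eventually (\<lambda>n. energy (V m) (V m) - 2 * energy (V n) (V m) \<le> e / 2) sequentially"
      by (auto simp: eventually_sequentially)
    moreover have "(\<lambda>n. energy (V m) (V m) - 2 * energy (V n) (V m)) \<longlonglongrightarrow> energy (V m) (V m) - 2 * 0"
      by (intro tendsto_intros lim)
    ultimately have "energy (V m) (V m) - 2 * 0 \<le> e / 2"
      by (intro tendsto_upperbound) auto
    then show ?thesis by simp
  qed
  show "\<exists>N. \<forall>m\<ge>N. norm (energy (V m) (V m) - 0) < e"
  proof (intro exI[of _ N] allI impI)
    fix m assume "m \<ge> N"
    then have "energy (V m) (V m) \<le> e / 2" by (rule small)
    then show "norm (energy (V m) (V m) - 0) < e" using \<open>e > 0\<close> energy_nonneg[OF V, of m] by simp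
  qed
qed

lemma form_approx_const: "F \<in> smooth_cyl \<Longrightarrow> form_approx (\<lambda>_. F) F"
  by (auto simp: form_approx_def smooth_cyl_Lp carre_cyl_def pd_def)

lemma carre_smooth_cyl:
  assumes "F \<in> smooth_cyl" "G \<in> smooth_cyl" shows "carre F G (carre_cyl F G)"
  unfolding carre_def using assms
  by (intro conjI integrable_carre_cyl exI[of _ "\<lambda>_. F"] exI[of _ "\<lambda>_. G"] form_approx_const) auto

lemma form_approx_energy_bounded:
  assumes "form_approx Fs F"
  obtains B where "\<And>n. energy (Fs n) (Fs n) \<le> B"
proof -
  have Fs: "Fs n \<in> smooth_cyl" for n using assms by (auto simp: form_approx_def)
  obtain N where N: "\<And>n. n \<ge> N \<Longrightarrow> energy (\<lambda>y. Fs n y - Fs N y) (\<lambda>y. Fs n y - Fs N y) < 1"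
    using assms unfolding form_approx_def energy_def by (meson order_refl zero_less_one)
  have "energy (Fs n) (Fs n) \<le> 2 + 2 * energy (Fs N) (Fs N)" if n: "n \<ge> N" for n
  proof -
    let ?D = "\<lambda>y. Fs n y - Fs N y"
    have D: "?D \<in> smooth_cyl" by (intro smooth_cyl_diff Fs)
    \<comment> \<open>This nonnegativity bounds twice the mixed energy by the sum of the two
      energies, as in the parallelogram estimate; N makes the energy of \<open>?D\<close> less than
      1.\<close>
    have "0 \<le> energy (\<lambda>y. ?D y - Fs N y) (\<lambda>y. ?D y - Fs N y)" by (intro energy_nonneg smooth_cyl_diff D Fs)
    also have "\<dots> = energy ?D ?D - 2 * energy ?D (Fs N) + energy (Fs N) (Fs N)" by (intro energy_diff_self D Fs)
    finally have "2 * energy ?D (Fs N) \<le> 1 + energy (Fs N) (Fs N)" using N[OF n] by linarith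
    moreover have "energy ?D (Fs N) = energy (Fs n) (Fs N) - energy (Fs N) (Fs N)" by (intro energy_diff_left Fs)
    moreover have "energy ?D ?D = energy (Fs n) (Fs n) - 2 * energy (Fs n) (Fs N) + energy (Fs N) (Fs N)"
      by (intro energy_diff_self Fs)
    ultimately show ?thesis using N[OF n] by linarith
  qed
  moreover have "energy (Fs n) (Fs n) \<le> (\<Sum>k<N. energy (Fs k) (Fs k))" if "n < N" for n
    using that by (intro member_le_sum energy_nonneg Fs) auto
  moreover have "0 \<le> (\<Sum>k<N. energy (Fs k) (Fs k))" by (intro sum_nonneg energy_nonneg Fs)
  moreover have "0 \<le> energy (Fs N) (Fs N)" by (intro energy_nonneg Fs)
  ultimately have "energy (Fs n) (Fs n) \<le> 2 + 2 * energy (Fs N) (Fs N) + (\<Sum>k<N. energy (Fs k) (Fs k))" for n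
    by (smt (verit) not_less)
  then show thesis by (rule that)
qed

text \<open>The version H comes from arbitrary approximations \<open>Rs\<close> of R. The
  differences \<open>V\<close> tend to 0 in L^2 and are Cauchy in energy, so closability makes their
  energies vanish; as the energies of \<open>Fs\<close> are bounded, Cauchy-Schwarz allows
  \<open>Rs\<close> to be replaced by R. For R itself integration by parts is exact and only an L^2
  limit in F remains.\<close>

lemma generator_smooth_in:
  assumes R: "smooth_in n R"
  shows "generator R (ornstein_uhlenbeck n R)"
  unfolding generator_def
proof (intro conjI ballI allI impI)
  let ?L = "ornstein_uhlenbeck n R"
  have R': "R \<in> smooth_cyl" using R smooth_cyl_iff by blast
  show "R \<in> dom_form" using form_approx_const[OF R'] by (auto simp: dom_form_def)
  show L: "?L \<in> Lp_wiener 2" by (intro tame_Lp[OF tame_ornstein_uhlenbeck[OF R]]) simp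
  fix F H assume "carre F R H"
  then obtain Fs Rs where H: "integrable wiener H" and Fs: "form_approx Fs F" and Rs: "form_approx Rs R"
    and lim: "(\<lambda>n. \<integral>y. \<bar>carre_cyl (Fs n) (Rs n) y - H y\<bar> \<partial>wiener) \<longlonglongrightarrow> 0"
    unfolding carre_def by blast
  have FsS: "Fs j \<in> smooth_cyl" and RsS: "Rs j \<in> smooth_cyl" for j using Fs Rs by (auto simp: form_approx_def)
  define V where "V j = (\<lambda>y. Rs j y - R y)" for j
  have VS: "V j \<in> smooth_cyl" for j unfolding V_def by (intro smooth_cyl_diff RsS R')
  have "(\<lambda>j. energy (V j) (V j)) \<longlonglongrightarrow> 0"
  proof (rule energy_closable[OF VS])
    show "(\<lambda>j. \<integral>y. (V j y)\<^sup>2 \<partial>wiener) \<longlonglongrightarrow> 0" using Rs by (simp add: form_approx_def V_def)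
    show "\<exists>N. \<forall>m\<ge>N. \<forall>n\<ge>N. energy (\<lambda>y. V m y - V n y) (\<lambda>y. V m y - V n y) < e" if "e > 0" for e
      using Rs that by (simp add: form_approx_def V_def energy_def)
  qed
  moreover obtain B where B: "\<And>j. energy (Fs j) (Fs j) \<le> B" using form_approx_energy_bounded[OF Fs] by blast
  ultimately have BV: "(\<lambda>j. B * energy (V j) (V j)) \<longlonglongrightarrow> 0"
    by (intro tendsto_mult_right_zero)
  have "(\<lambda>j. (energy (Fs j) (V j))\<^sup>2) \<longlonglongrightarrow> 0"
  proof (rule Lim_null_comparison[OF _ BV])
    show "\<forall>\<^sub>F j in sequentially. norm ((energy (Fs j) (V j))\<^sup>2) \<le> B * energy (V j) (V j)"
    proof (intro always_eventually allI)
      fix j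
      have "(energy (Fs j) (V j))\<^sup>2 \<le> energy (Fs j) (Fs j) * energy (V j) (V j)"
        by (intro energy_Cauchy_Schwarz FsS VS)
      also have "\<dots> \<le> B * energy (V j) (V j)" by (intro mult_right_mono B energy_nonneg VS)
      finally show "norm ((energy (Fs j) (V j))\<^sup>2) \<le> B * energy (V j) (V j)" by simp
    qed
  qed
  then have 1: "(\<lambda>j. energy (Fs j) (V j)) \<longlonglongrightarrow> 0" by (rule power_tendsto_0_iff[THEN iffD1, rotated]) simp
  have F2: "F \<in> Lp_wiener 2" using Fs by (simp add: form_approx_def)
  have "(\<lambda>j. \<integral>y. (Fs j y - F y) * ?L y \<partial>wiener) \<longlonglongrightarrow> 0"
    using Lp_wiener_2_diff[OF smooth_cyl_Lp[OF FsS] F2] L Fs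
    by (intro tendsto_integral_mult_L2) (auto simp: Lp_wiener_2_iff form_approx_def)
  moreover have "(\<integral>y. (Fs j y - F y) * ?L y \<partial>wiener) = - energy (Fs j) R - (\<integral>y. F y * ?L y \<partial>wiener)" for j
  proof -
    obtain l where "smooth_in l (Fs j)" using FsS smooth_cyl_iff by blast
    from energy_eq_ornstein_uhlenbeck[OF this R]
    have "energy (Fs j) R = - (\<integral>y. Fs j y * ?L y \<partial>wiener)" .
    moreover have "integrable wiener (\<lambda>y. Fs j y * ?L y)" "integrable wiener (\<lambda>y. F y * ?L y)"
      using smooth_cyl_Lp[OF FsS, of 2 j] F2 L by (auto intro!: integral_Cauchy_Schwarz(1) simp: Lp_wiener_2_iff)
    ultimately show ?thesis by (simp add: left_diff_distrib)
  qed
  ultimately have 2: "(\<lambda>j. - energy (Fs j) R - (\<integral>y. F y * ?L y \<partial>wiener)) \<longlonglongrightarrow> 0" by simp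
  have "(\<lambda>j. energy (Fs j) (Rs j) - (\<integral>y. H y \<partial>wiener)) \<longlonglongrightarrow> 0"
  proof (rule Lim_null_comparison[OF _ lim], intro always_eventually allI)
    fix j
    have "energy (Fs j) (Rs j) - (\<integral>y. H y \<partial>wiener) = (\<integral>y. carre_cyl (Fs j) (Rs j) y - H y \<partial>wiener)"
      using integrable_carre_cyl[OF FsS RsS] H by (simp add: energy_def)
    then show "norm (energy (Fs j) (Rs j) - (\<integral>y. H y \<partial>wiener)) \<le> (\<integral>y. \<bar>carre_cyl (Fs j) (Rs j) y - H y\<bar> \<partial>wiener)"
      by (simp add: integral_abs_bound)
  qed
  moreover have "energy (Fs j) (V j) = energy (Fs j) (Rs j) - energy (Fs j) R" for j
    unfolding V_def using energy_diff_left[OF RsS R' FsS] by (simp add: energy_commute[of "Fs j"])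
  \<comment> \<open>Three null sequences are combined so that every term depending on j cancels,
    leaving a constant sequence with limit 0.\<close>
  ultimately have "(\<lambda>j. (energy (Fs j) (Rs j) - (\<integral>y. H y \<partial>wiener)) - (energy (Fs j) (Rs j) - energy (Fs j) R)
      + (- energy (Fs j) R - (\<integral>y. F y * ?L y \<partial>wiener))) \<longlonglongrightarrow> 0 - 0 + 0"
    using 1 2 by (intro tendsto_intros) auto
  then have "(\<lambda>j::nat. - (\<integral>y. H y \<partial>wiener) - (\<integral>y. F y * ?L y \<partial>wiener)) \<longlonglongrightarrow> 0" by simp
  then have "- (\<integral>y. H y \<partial>wiener) - (\<integral>y. F y * ?L y \<partial>wiener) = 0" by (simp add: LIMSEQ_const_iff)
  then show "(\<integral>y. H y \<partial>wiener) = - (\<integral>y. F y * ?L y \<partial>wiener)" by simp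
qed

section \<open>Functions of the first coordinate\<close>

definition poly_growth :: "(real \<Rightarrow> real) \<Rightarrow> bool" where
  "poly_growth f \<longleftrightarrow> (\<exists>C m. \<forall>x. \<bar>f x\<bar> \<le> C * (1 + \<bar>x\<bar>) ^ m)"

definition on_first :: "(real \<Rightarrow> real) \<Rightarrow> (nat \<Rightarrow> real) \<Rightarrow> real" where
  "on_first f y = f (y 0)"

lemma tame_on_first:
  assumes "continuous_on UNIV f" "poly_growth f" shows "tame 1 (on_first f)"
proof -
  obtain C m where "\<And>x. \<bar>f x\<bar> \<le> C * (1 + \<bar>x\<bar>) ^ m" using assms(2) by (auto simp: poly_growth_def)
  moreover have "continuous_on UNIV (on_first f)"
    unfolding on_first_def[abs_def] by (rule continuous_on_compose2[OF assms(1)]) (auto intro!: continuous_intros)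
  ultimately show ?thesis by (intro tameI[where C=C and m=m]) (simp_all add: on_first_def)
qed

lemma pd_on_first:
  assumes "\<And>x. (f has_real_derivative f' x) (at x)"
  shows "pd k (on_first f) = on_first (if k = 0 then f' else (\<lambda>_. 0))"
  by (intro ext pd_eqI) (auto simp: on_first_def assms)

text \<open>The zero function has to belong to \<open>S\<close> because it is the partial derivative
  in every direction other than 0.\<close>

lemma smooth_in_on_first:
  assumes "f \<in> S" and zero: "(\<lambda>_. 0) \<in> S"
    and growth: "\<And>f. f \<in> S \<Longrightarrow> poly_growth f"
    and deriv: "\<And>f. f \<in> S \<Longrightarrow> \<exists>f'\<in>S. \<forall>x. (f has_real_derivative f' x) (at x)"
  shows "smooth_in 1 (on_first f)"
proof (rule smooth_in_coinduct[where S="on_first ` S"])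
  show "on_first f \<in> on_first ` S" using assms(1) by blast
next
  fix F assume "F \<in> on_first ` S"
  then obtain f where f: "f \<in> S" "F = on_first f" by blast
  then obtain f' where f': "f' \<in> S" "\<And>x. (f has_real_derivative f' x) (at x)" using deriv by blast
  show "depends_on 1 F" by (simp add: f(2) depends_on_def on_first_def)
  have "continuous_on UNIV f"
    using f'(2) by (meson DERIV_isCont continuous_at_imp_continuous_on)
  then show "tame 1 F" unfolding f(2) using growth[OF f(1)] by (rule tame_on_first)
  show "(\<lambda>t. F (y(k := t))) differentiable (at (y k))" for k y
    using f'(2) by (cases "k = 0") (auto simp: f(2) on_first_def real_differentiable_def)
  show "pd k F \<in> on_first ` S" for k
    unfolding f(2) pd_on_first[OF f'(2)] using f'(1) zero by (intro imageI) simp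
qed

text \<open>Stability of \<open>T\<close> lets the pointwise iterates of the operator serve as the
  versions \<open>U k\<close>, all with the same n.\<close>

lemma smooth_in_imp_D_infty:
  assumes "F \<in> T" and T: "\<And>F. F \<in> T \<Longrightarrow> smooth_in n F" "\<And>F. F \<in> T \<Longrightarrow> ornstein_uhlenbeck n F \<in> T"
  shows "F \<in> D_infty"
proof -
  define U where "U k = (ornstein_uhlenbeck n ^^ k) F" for k
  have U: "U k \<in> T" for k by (induction k) (auto simp: U_def assms)
  have "generator (U k) (U (Suc k))" for k
    using generator_smooth_in[OF T(1)[OF U]] by (simp add: U_def)
  moreover have "U k \<in> Lp_wiener p" if "p > 1" for k p
    using that by (intro tame_Lp[OF smooth_in_tame[OF T(1)[OF U]]]) simp
  ultimately show ?thesis unfolding D_infty_def by (intro CollectI exI[of _ U]) (auto simp: U_def)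
qed

section \<open>Polynomial growth and differential algebras on the line\<close>

lemma poly_growth_const: "poly_growth (\<lambda>_. c)"
  unfolding poly_growth_def by (intro exI[of _ "\<bar>c\<bar>"] exI[of _ 0]) auto

lemma poly_growth_id: "poly_growth (\<lambda>x. x)"
  unfolding poly_growth_def by (intro exI[of _ 1]) auto

lemma poly_growthE:
  assumes "poly_growth f"
  obtains C m where "C \<ge> 0" "\<And>x. \<bar>f x\<bar> \<le> C * (1 + \<bar>x\<bar>) ^ m"
proof -
  from assms obtain C m where C: "\<And>x. \<bar>f x\<bar> \<le> C * (1 + \<bar>x\<bar>) ^ m" by (auto simp: poly_growth_def)
  have "C \<ge> 0" using C[of 0] by simp
  then show thesis using C by (rule that)
qed

lemma poly_growth_add:
  assumes "poly_growth f" "poly_growth h" shows "poly_growth (\<lambda>x. f x + h x)"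
proof -
  obtain C m where C: "C \<ge> 0" "\<And>x. \<bar>f x\<bar> \<le> C * (1 + \<bar>x\<bar>) ^ m" using poly_growthE[OF assms(1)] by blast
  obtain D l where D: "D \<ge> 0" "\<And>x. \<bar>h x\<bar> \<le> D * (1 + \<bar>x\<bar>) ^ l" using poly_growthE[OF assms(2)] by blast
  have "\<bar>f x + h x\<bar> \<le> (C + D) * (1 + \<bar>x\<bar>) ^ (m + l)" for x
  proof -
    have "\<bar>f x\<bar> \<le> C * (1 + \<bar>x\<bar>) ^ (m + l)"
      using C(1) by (intro order_trans[OF C(2)] mult_left_mono power_increasing) auto
    moreover have "\<bar>h x\<bar> \<le> D * (1 + \<bar>x\<bar>) ^ (m + l)"
      using D(1) by (intro order_trans[OF D(2)] mult_left_mono power_increasing) auto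
    ultimately show ?thesis by (simp add: distrib_right)
  qed
  then show ?thesis unfolding poly_growth_def by blast
qed

lemma poly_growth_mult:
  assumes "poly_growth f" "poly_growth h" shows "poly_growth (\<lambda>x. f x * h x)"
proof -
  obtain C m where C: "C \<ge> 0" "\<And>x. \<bar>f x\<bar> \<le> C * (1 + \<bar>x\<bar>) ^ m" using poly_growthE[OF assms(1)] by blast
  obtain D l where D: "D \<ge> 0" "\<And>x. \<bar>h x\<bar> \<le> D * (1 + \<bar>x\<bar>) ^ l" using poly_growthE[OF assms(2)] by blast
  have "\<bar>f x * h x\<bar> \<le> (C * D) * (1 + \<bar>x\<bar>) ^ (m + l)" for x
  proof -
    have "\<bar>f x * h x\<bar> \<le> (C * (1 + \<bar>x\<bar>) ^ m) * (D * (1 + \<bar>x\<bar>) ^ l)"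
      unfolding abs_mult using C D order_trans[OF abs_ge_zero C(2)] by (intro mult_mono) auto
    then show ?thesis by (simp add: power_add mult_ac)
  qed
  then show ?thesis unfolding poly_growth_def by blast
qed

text \<open>Real polynomials in the members of \<open>A\<close>. In this form growth and
  differentiability reduce to the generators by rule induction, the product case of the latter being
  the Leibniz rule.\<close>

inductive_set generated_algebra :: "(real \<Rightarrow> real) set \<Rightarrow> (real \<Rightarrow> real) set" for A where
  generator: "f \<in> A \<Longrightarrow> f \<in> generated_algebra A"
| const: "(\<lambda>_. c) \<in> generated_algebra A"
| add: "f \<in> generated_algebra A \<Longrightarrow> h \<in> generated_algebra A \<Longrightarrow> (\<lambda>x. f x + h x) \<in> generated_algebra A"
| mult: "f \<in> generated_algebra A \<Longrightarrow> h \<in> generated_algebra A \<Longrightarrow> (\<lambda>x. f x * h x) \<in> generated_algebra A"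

lemma generated_algebra_diff:
  assumes "f \<in> generated_algebra A" "h \<in> generated_algebra A"
  shows "(\<lambda>x. f x - h x) \<in> generated_algebra A"
  using generated_algebra.add[OF assms(1) generated_algebra.mult[OF generated_algebra.const[of "-1"] assms(2)]]
  by simp

lemma poly_growth_generated_algebra:
  assumes "f \<in> generated_algebra A" "\<And>f. f \<in> A \<Longrightarrow> poly_growth f"
  shows "poly_growth f"
  using assms(1) by induction (auto intro: assms(2) poly_growth_const poly_growth_add poly_growth_mult)

lemma generated_algebra_derivative:
  assumes "f \<in> generated_algebra A"
    and "\<And>f. f \<in> A \<Longrightarrow> \<exists>f'\<in>generated_algebra A. \<forall>x. (f has_real_derivative f' x) (at x)"
  shows "\<exists>f'\<in>generated_algebra A. \<forall>x. (f has_real_derivative f' x) (at x)"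
  using assms(1)
proof induction
  case (generator f)
  then show ?case by (rule assms(2))
next
  case (const c)
  show ?case by (rule bexI[OF _ generated_algebra.const[of 0]]) simp
next
  case (add f h)
  then obtain f' h' where *: "f' \<in> generated_algebra A" "h' \<in> generated_algebra A"
    and "\<forall>x. (f has_real_derivative f' x) (at x)" "\<forall>x. (h has_real_derivative h' x) (at x)" by blast
  then show ?case
    by (intro bexI[OF _ generated_algebra.add[OF *]]) (auto intro!: derivative_intros)
next
  case (mult f h)
  then obtain f' h' where *: "f' \<in> generated_algebra A" "h' \<in> generated_algebra A"
    and d: "\<forall>x. (f has_real_derivative f' x) (at x)" "\<forall>x. (h has_real_derivative h' x) (at x)" by blast
  have "(\<lambda>x. f' x * h x + h' x * f x) \<in> generated_algebra A"
    by (intro generated_algebra.add generated_algebra.mult * mult.hyps)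
  then show ?case by (rule bexI[rotated]) (use d in \<open>auto intro!: DERIV_mult\<close>)
qed

text \<open>On functions of one coordinate the operator is f'' - x f'. Closure under differentiation
  together with the presence of x makes it map the algebra into itself.\<close>

lemma on_first_in_D_infty:
  assumes x: "(\<lambda>x. x) \<in> A" and f: "f \<in> generated_algebra A"
    and growth: "\<And>f. f \<in> A \<Longrightarrow> poly_growth f"
    and deriv: "\<And>f. f \<in> A \<Longrightarrow> \<exists>f'\<in>generated_algebra A. \<forall>x. (f has_real_derivative f' x) (at x)"
  shows "on_first f \<in> D_infty" "smooth_in 1 (on_first f)"
proof -
  let ?S = "generated_algebra A"
  have smooth: "smooth_in 1 (on_first f)" if "f \<in> ?S" for f
    using that
    by (rule smooth_in_on_first)
      (auto intro: generated_algebra.const poly_growth_generated_algebra[OF _ growth] generated_algebra_derivative[OF _ deriv])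
  then show "smooth_in 1 (on_first f)" using f by blast
  show "on_first f \<in> D_infty"
  proof (rule smooth_in_imp_D_infty[where T="on_first ` ?S" and n=1])
    fix F assume "F \<in> on_first ` ?S"
    then obtain f where f: "f \<in> ?S" "F = on_first f" by blast
    show "smooth_in 1 F" unfolding f(2) by (rule smooth[OF f(1)])
    obtain f' where f': "f' \<in> ?S" "\<And>x. (f has_real_derivative f' x) (at x)"
      using generated_algebra_derivative[OF f(1) deriv] by blast
    obtain f'' where f'': "f'' \<in> ?S" "\<And>x. (f' has_real_derivative f'' x) (at x)"
      using generated_algebra_derivative[OF f'(1) deriv] by blast
    have "ornstein_uhlenbeck 1 F = on_first (\<lambda>x. f'' x - x * f' x)"
      by (simp add: ornstein_uhlenbeck_def fun_eq_iff on_first_def f(2) pd_on_first[OF f'(2)] pd_on_first[OF f''(2)])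
    moreover have "(\<lambda>x. f'' x - x * f' x) \<in> ?S"
      by (intro generated_algebra_diff generated_algebra.mult generated_algebra.generator x f' f'')
    ultimately show "ornstein_uhlenbeck 1 F \<in> on_first ` ?S" by blast
  qed (use f in blast)
qed

lemma carre_on_first:
  assumes "smooth_in 1 (on_first f)" and deriv: "\<And>x. (f has_real_derivative f' x) (at x)"
  shows "carre (on_first f) (on_first f) (on_first (\<lambda>x. (f' x)\<^sup>2))"
proof -
  have "carre_cyl (on_first f) (on_first f) = on_first (\<lambda>x. (f' x)\<^sup>2)"
    using carre_cyl_eq_sum[OF disjI1[OF smooth_in_depends[OF assms(1)]], of "on_first f"]
    by (simp add: fun_eq_iff pd_on_first[OF deriv] power2_eq_square on_first_def)
  moreover have "on_first f \<in> smooth_cyl" using assms(1) smooth_cyl_iff by blast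
  ultimately show ?thesis using carre_smooth_cyl by metis
qed

text \<open>The lower bound turns f^(-2 \<theta>) into at most a constant times exp(2 \<theta> k
  x^2), integrable against the normal law when 2 \<theta> k < 1/2. The choice \<theta> = 1/(8 k)
  gives 1/4 and leaves exp(-x^2/4), a multiple of the normal density of variance 2.\<close>

lemma neg_moment_on_first_finite:
  assumes [measurable]: "f \<in> borel_measurable borel"
    and ck: "c > 0" "k > 0" "\<And>x. c * exp (- k * x\<^sup>2) \<le> f x"
  shows "neg_moment (1 / (8 * k)) (on_first (\<lambda>x. (f x)\<^sup>2)) < \<infinity>"
proof -
  define \<theta> where "\<theta> = 1 / (8 * k)"
  have \<theta>: "\<theta> > 0" "2 * \<theta> * k = 1 / 4" using ck by (simp_all add: \<theta>_def)
  let ?K = "c powr (- 2 * \<theta>) * sqrt 2"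
  have pos: "f x > 0" for x using ck(1) ck(3)[of x] by (intro less_le_trans[OF _ ck(3)]) simp
  then have nz: "f x \<noteq> 0" for x by (metis less_irrefl)
  have bound: "((f x)\<^sup>2) powr (- \<theta>) * std_normal_density x \<le> ?K * normal_density 0 (sqrt 2) x" for x
  proof -
    let ?z = "c * exp (- k * x\<^sup>2)"
    have z: "?z > 0" using ck(1) by simp
    have "((f x)\<^sup>2) powr (- \<theta>) \<le> (?z\<^sup>2) powr (- \<theta>)"
      using z ck(3)[of x] \<theta> by (intro powr_mono2' power_mono) auto
    also have "\<dots> = c powr (- 2 * \<theta>) * exp ((2 * \<theta> * k) * x\<^sup>2)"
      using ck(1) by (simp add: powr_def ln_mult ln_realpow exp_add[symmetric] algebra_simps)
    finally have "((f x)\<^sup>2) powr (- \<theta>) * std_normal_density x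
        \<le> c powr (- 2 * \<theta>) * exp (1 / 4 * x\<^sup>2) * std_normal_density x"
      unfolding \<theta>(2) by (intro mult_right_mono) auto
    also have "exp (1 / 4 * x\<^sup>2) * std_normal_density x = sqrt 2 * normal_density 0 (sqrt 2) x"
    proof -
      have "exp (1 / 4 * x\<^sup>2) * exp (- x\<^sup>2 / 2) = exp (- x\<^sup>2 / 4)" by (simp flip: exp_add)
      then show ?thesis by (simp add: normal_density_def real_sqrt_mult field_simps)
    qed
    then have "c powr (- 2 * \<theta>) * exp (1 / 4 * x\<^sup>2) * std_normal_density x = ?K * normal_density 0 (sqrt 2) x"
      by (simp add: mult.assoc)
    finally show ?thesis .
  qed
  have "neg_moment \<theta> (on_first (\<lambda>x. (f x)\<^sup>2)) = (\<integral>\<^sup>+y. ennreal (((f (y 0))\<^sup>2) powr (- \<theta>)) \<partial>wiener)"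
    unfolding neg_moment_def on_first_def using nz by (intro nn_integral_cong) simp
  also have "\<dots> = (\<integral>\<^sup>+x. ennreal (((f x)\<^sup>2) powr (- \<theta>)) \<partial>distr wiener std_normal_distribution (\<lambda>y. y 0))"
    by (subst nn_integral_distr) auto
  also have "\<dots> = (\<integral>\<^sup>+x. ennreal (std_normal_density x) * ennreal (((f x)\<^sup>2) powr (- \<theta>)) \<partial>lborel)"
    unfolding distr_wiener_coord by (subst nn_integral_density) auto
  also have "\<dots> \<le> (\<integral>\<^sup>+x. ennreal (?K * normal_density 0 (sqrt 2) x) \<partial>lborel)"
    using bound by (intro nn_integral_mono) (simp add: ennreal_leI mult.commute flip: ennreal_mult)
  also have "\<dots> = ennreal (\<integral>x. ?K * normal_density 0 (sqrt 2) x \<partial>lborel)"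
    by (intro nn_integral_eq_integral) (auto intro!: integrable_mult_right integrable_normal_density)
  also have "\<dots> < \<infinity>" by simp
  finally show ?thesis by (simp add: \<theta>_def)
qed

section \<open>The law of the transported coordinate and the conclusion\<close>

lemma Phi_strict_mono: assumes "x < y" shows "\<Phi> x < \<Phi> y"
proof (rule DERIV_pos_imp_increasing[OF assms])
  fix t
  have "std_normal_density t > 0" by (simp add: normal_density_pos)
  then show "\<exists>d. (\<Phi> has_real_derivative d) (at t) \<and> 0 < d"
    using Phi_has_real_derivative[of t] by blast
qed

lemma Phi_le_iff: "\<Phi> x \<le> \<Phi> y \<longleftrightarrow> x \<le> y"
  using Phi_strict_mono by (metis linorder_not_less order_less_imp_le order_le_less)

lemma Phi_surj: assumes "0 < p" "p < 1" obtains y where "\<Phi> y = p"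
proof -
  interpret real_distribution std_normal_distribution by (rule real_distribution_std_normal)
  have "eventually (\<lambda>x. \<Phi> x > p) at_top" using cdf_lim_at_top_prob assms(2) by (rule order_tendstoD)
  then obtain b where b: "\<And>x. x \<ge> b \<Longrightarrow> \<Phi> x > p" by (auto simp: eventually_at_top_linorder)
  have "eventually (\<lambda>x. \<Phi> x < p) at_bot" using cdf_lim_at_bot assms(1) by (rule order_tendstoD)
  then obtain a where a: "\<And>x. x \<le> a \<Longrightarrow> \<Phi> x < p" by (auto simp: eventually_at_bot_linorder)
  have "\<exists>x. min a b \<le> x \<and> x \<le> b \<and> \<Phi> x = p"
    using a[of "min a b"] b[of b] Phi_has_real_derivative
    by (intro IVT) (auto intro: DERIV_isCont less_imp_le)
  then show thesis using that by blast
qed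

text \<open>For x > 0 the value F(x) lies strictly between 0 and 1, hence equals \<Phi>(y0) for some
  y0, and monotonicity turns the event g \<le> x into the half-line up to y0. For x \<le> 0 both
  distribution functions vanish.\<close>

lemma gamma_law_transport:
  assumes a: "a > -1"
  shows "distr wiener borel (on_first (transport a)) = gamma_law a"
proof -
  have cont: "continuous_on UNIV (transport a)"
    using transport_has_real_derivative[OF a] by (meson DERIV_isCont continuous_at_imp_continuous_on)
  then have [measurable]: "transport a \<in> borel_measurable borel" by (rule borel_measurable_continuous_onI)
  let ?N = std_normal_distribution
  interpret N: real_distribution ?N by (rule real_distribution_std_normal)
  interpret G: real_distribution "gamma_law a" using a by (rule real_distribution_gamma_law)
  have "distr wiener borel (on_first (transport a)) = distr (distr wiener ?N (\<lambda>y. y 0)) borel (transport a)"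
    by (subst distr_distr) (auto simp: comp_def on_first_def[abs_def])
  also have "\<dots> = distr ?N borel (transport a)" by (simp add: distr_wiener_coord)
  also have "\<dots> = gamma_law a"
  proof (rule cdf_unique)
    show "real_distribution (distr ?N borel (transport a))" by simp
    show "real_distribution (gamma_law a)" using a by (rule real_distribution_gamma_law)
    show "cdf (distr ?N borel (transport a)) = cdf (gamma_law a)"
    proof
      fix x
      have "cdf (distr ?N borel (transport a)) x = measure ?N {y. transport a y \<le> x}"
        by (simp add: cdf_def measure_distr vimage_def)
      also have "\<dots> = cdf (gamma_law a) x"
      proof (cases "x > 0")
        case True
        have "0 < cdf (gamma_law a) x"
          using gamma_cdf_strict_mono[OF a, of "x / 2" x] G.cdf_nonneg[of "x / 2"] True by simp
        moreover have "cdf (gamma_law a) x < 1"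
          using gamma_cdf_strict_mono[OF a, of x "x + 1"] G.cdf_bounded_prob[of "x + 1"] True by simp
        ultimately obtain y0 where y0: "\<Phi> y0 = cdf (gamma_law a) x" using Phi_surj by blast
        have "{y. transport a y \<le> x} = {..y0}"
          using transport_le_iff[OF a True] by (auto simp: y0[symmetric] Phi_le_iff)
        then show ?thesis using y0 by (simp only: cdf_def)
      next
        case False
        then have "{y. transport a y \<le> x} = {}" using less_le_trans[OF transport_pos[OF a], of _ x] by auto
        then show ?thesis using False gamma_cdf_nonpos[OF a, of x] by simp
      qed
      finally show "cdf (distr ?N borel (transport a)) x = cdf (gamma_law a) x" .
    qed
  qed
  finally show ?thesis .
qed

lemma poly_growth_transport: assumes "a > -1" shows "poly_growth (transport a)"
proof -
  obtain C where C: "\<And>y. transport a y \<le> 2 * y\<^sup>2 + C" using transport_le[OF assms] by blast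
  have "poly_growth (\<lambda>y. 2 * (y * y) + C)"
    by (intro poly_growth_add poly_growth_mult poly_growth_const poly_growth_id)
  then obtain D m where "\<And>y. \<bar>2 * (y * y) + C\<bar> \<le> D * (1 + \<bar>y\<bar>) ^ m" by (auto simp: poly_growth_def)
  then have "\<bar>transport a y\<bar> \<le> D * (1 + \<bar>y\<bar>) ^ m" for y
    using C[of y] transport_pos[OF assms, of y] by (smt (verit) power2_eq_square)
  then show ?thesis by (auto simp: poly_growth_def)
qed

lemma poly_growth_log_slope: assumes "a > -1" shows "poly_growth (log_slope a)"
proof -
  obtain C where C: "\<And>y. log_slope a y \<le> C * (1 + \<bar>y\<bar>)" using log_slope_le[OF assms] by blast
  then have "\<bar>log_slope a y\<bar> \<le> C * (1 + \<bar>y\<bar>) ^ 1" for y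
    using log_slope_pos[OF assms, of y] by simp
  then show ?thesis unfolding poly_growth_def by blast
qed

theorem theorem3p4:
  fixes a :: real
  assumes "a > -1"
  shows "gamma_law a \<in> regular_laws"
proof -
  note a = assms
  \<comment> \<open>The coordinate itself is a generator because both the equation for q' and the
    operator f'' - y f' involve y.\<close>
  define A where "A = {\<lambda>y. y, transport a, log_slope a}"
  have A: "(\<lambda>y. y) \<in> A" "transport a \<in> A" "log_slope a \<in> A" by (auto simp: A_def)
  have S: "(\<lambda>y. y) \<in> generated_algebra A" "transport a \<in> generated_algebra A" "log_slope a \<in> generated_algebra A"
    using A by (auto intro: generated_algebra.generator)
  have growth: "poly_growth f" if "f \<in> A" for f
    using that poly_growth_transport[OF a] poly_growth_log_slope[OF a] poly_growth_id by (auto simp: A_def)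
  have deriv: "\<exists>f'\<in>generated_algebra A. \<forall>x. (f has_real_derivative f' x) (at x)" if f: "f \<in> A" for f
  proof -
    consider "f = (\<lambda>y. y)" | "f = transport a" | "f = log_slope a" using f by (auto simp: A_def)
    then show ?thesis
    proof cases
      case 1
      then show ?thesis by (intro bexI[OF _ generated_algebra.const[of 1]]) simp
    next
      case 2
      have "(\<lambda>y. transport a y * log_slope a y) \<in> generated_algebra A" by (intro generated_algebra.mult S)
      then show ?thesis
        unfolding 2 by (rule bexI[rotated]) (intro allI transport_has_real_derivative[OF a])
    next
      case 3
      have "(\<lambda>y. log_slope a y * (transport a y * log_slope a y - y - (a + 1) * log_slope a y)) \<in> generated_algebra A"
        by (intro generated_algebra_diff generated_algebra.mult generated_algebra.const S)
      moreover have "(log_slope a has_real_derivative log_slope a y * (transport a y * log_slope a y - y - (a + 1) * log_slope a y)) (at y)" for y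
        using log_slope_has_real_derivative[OF a, of y] by (simp add: algebra_simps)
      ultimately show ?thesis unfolding 3 by (intro bexI[rotated]) auto
    qed
  qed
  let ?X = "on_first (transport a)"
  have X: "?X \<in> D_infty" "smooth_in 1 ?X"
    using on_first_in_D_infty[OF A(1) S(2) growth deriv] by blast+
  have H: "carre ?X ?X (on_first (\<lambda>y. (transport a y * log_slope a y)\<^sup>2))"
    by (rule carre_on_first[OF X(2) transport_has_real_derivative[OF a]])
  obtain c k where ck: "c > 0" "k > 0" "\<And>y. c * exp (- k * y\<^sup>2) \<le> transport a y * log_slope a y"
    using transport_mult_log_slope_ge[OF a] by blast
  have "continuous_on UNIV (\<lambda>y. transport a y * log_slope a y)"
    using transport_has_real_derivative[OF a] log_slope_has_real_derivative[OF a]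
    by (intro continuous_intros) (meson DERIV_isCont continuous_at_imp_continuous_on)+
  then have "neg_moment (1 / (8 * k)) (on_first (\<lambda>y. (transport a y * log_slope a y)\<^sup>2)) < \<infinity>"
    by (intro neg_moment_on_first_finite[OF borel_measurable_continuous_onI ck])
  moreover have "1 / (8 * k) > 0" using ck by simp
  ultimately show ?thesis
    unfolding regular_laws_def using X(1) gamma_law_transport[OF a] H by blast
qed

end
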